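(* Let $T>0$, let $p\colon\mathbb{R}\to\mathbb{C}$ be periodic with period $T$ and absolutely integrable over one period, and let $k\in\mathbb{N}\setminus\{0\}$. Then $$\int_{-\infty}^{\infty}\operatorname{sinc}^{k}(x)\,p(x)\,dx=\sum_{\substack{n\in\mathbb{Z}\\ |n/T|\leq k/2}}\hat{p}(n)\,\Pi^{*k}(n/T).$$ If $k\geq 2$, the range of summation may be reduced as follows: $$\int_{-\infty}^{\infty}\operatorname{sinc}^{k}(x)\,p(x)\,dx=\sum_{\substack{n\in\mathbb{Z}\\ |n/T|<k/2}}\hat{p}(n)\,\Pi^{*k}(n/T).$$
   Context: For a $T$-periodic function $p$ absolutely integrable over a period, $\hat p(n)=\int_{-T/2}^{T/2}e^{-2\pi i n x/T}p(x)\,dx$, $n\in\mathbb{Z}$. The normalized cardinal sine is $\operatorname{sinc}(x)=\frac{\sin \pi x}{\pi x}$ for $x\neq 0$ and $\operatorname{sinc}(0)=1$; $\operatorname{sinc}^k(x)$ denotes its $k$-th power. The function $\Pi\colon\mathbb{R}\to\mathbb{R}$ is given by $\Pi(x)=1$ for $|x|<1/2$, $\Pi(x)=1/2$ for $x=\pm 1/2$, and $\Pi(x)=0$ for $|x|>1/2$. Convolution is $(f*g)(x)=\int_{-\infty}^{\infty}f(y)g(x-y)\,dy$, and $\Pi^{*k}=\Pi*\cdots*\Pi$ ($k$ factors, so $\Pi^{*1}=\Pi$).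
   Formalization: The Fourier coefficient carries a factor 1/T (without it the identity fails for p=1, T=2, k=2), and for k=1 the integral over the line is the principal value, the limit of integrals over [-R,R], since it may otherwise diverge (T=2, p(x)=sin(πx)). *)

theory Defs
  imports "HOL-Analysis.Analysis"
begin

definition nsinc :: "real \<Rightarrow> real" where
  "nsinc x = (if x = 0 then 1 else sin (pi * x) / (pi * x))"

definition rect :: "real \<Rightarrow> real" where
  "rect x = (if \<bar>x\<bar> < 1/2 then 1 else if \<bar>x\<bar> = 1/2 then 1/2 else 0)"

definition fun_conv :: "(real \<Rightarrow> real) \<Rightarrow> (real \<Rightarrow> real) \<Rightarrow> real \<Rightarrow> real" where
  "fun_conv f g x = (LINT y|lebesgue. f y * g (x - y))"

text \<open>The convolution of \<open>k\<close> copies of \<open>f\<close>, for \<open>k \<ge> 1\<close>; the value at \<open>k = 0\<close> is irrelevant.\<close>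

definition conv_power :: "(real \<Rightarrow> real) \<Rightarrow> nat \<Rightarrow> real \<Rightarrow> real" where
  "conv_power f k = (fun_conv f ^^ (k - 1)) f"

text \<open>
  Fourier coefficients are normalized by the period, so that the constant function 1 has zeroth
  coefficient 1. Without the factor \<open>1 / T\<close> the identity
  \<open>\<integral> sinc^k p = \<Sum> p^(n) \<Pi>^{*k}(n/T)\<close> fails for \<open>p = 1\<close> and \<open>T \<noteq> 1\<close>: its left-hand side
  does not depend on \<open>T\<close>.
\<close>

definition fourier_coeff :: "real \<Rightarrow> (real \<Rightarrow> complex) \<Rightarrow> int \<Rightarrow> complex" where
  "fourier_coeff T p n =
     (LINT x:{-T/2..T/2}|lebesgue.
        exp (- 2 * complex_of_real pi * \<i> * of_int n * of_real x / of_real T) * p x) / of_real T"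

text \<open>
  The integral over the real line as a Cauchy principal value at infinity. For \<open>k = 1\<close> no stronger
  sense is possible: with \<open>T = 2\<close> and \<open>p x = sin (pi * x)\<close>, the integral of \<open>sinc * p\<close> over the
  positive half-line diverges.
  Local integrability is required so that the default value of a non-existing integral plays no role.
\<close>

definition has_pv_integral :: "(real \<Rightarrow> complex) \<Rightarrow> complex \<Rightarrow> bool" where
  "has_pv_integral f I \<longleftrightarrow>
     (\<forall>R. f absolutely_integrable_on {-R..R}) \<and>
     ((\<lambda>R. LINT x:{-R..R}|lebesgue. f x) \<longlongrightarrow> I) at_top"

end

theory Submission
  imports Defs "HOL-Probability.Sinc_Integral"
begin

text \<open>
  The identity is Poisson summation for \<open>f = sinc^k\<close>, paired with \<open>p\<close>. Cutting the real line into
  cells of length \<open>T\<close> turns the integral of \<open>f p\<close> over \<open>2N + 1\<close> cells into the integral over one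
  period of \<open>S\<^sub>N p\<close>, where \<open>S\<^sub>N(x)\<close> is the sum of \<open>f(x + jT)\<close> over \<open>|j| \<le> N\<close>
  (\<open>integral_eq_integral_periodization\<close>). The functions \<open>S\<^sub>N\<close> converge uniformly on bounded sets to
  some \<open>F\<close> (\<open>uniform_limit_periodization_nsinc_power\<close>). For \<open>k \<ge> 2\<close> this is the
  majorant test; for \<open>k = 1\<close> it needs the pairing of \<open>j\<close> with \<open>-j\<close>, which
  leaves a quadratically decaying term plus a multiple of the convergent series of
  \<open>sin(j \<pi> T) / j\<close>. Hence the integrals of \<open>f p\<close> tend to the integral of \<open>F p\<close> over a period for
  every \<open>T\<close>-periodic \<open>p\<close> integrable over a period.

  It remains to recognize \<open>F\<close> as the trigonometric polynomial with coefficients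
  \<open>\<Pi>^{*k}(n/T) / T\<close> (\<open>poisson_summation_nsinc_power\<close>). Applying the
  same limit to \<open>p(x) = e^{2 \<pi> i n x / T}\<close> shows that the Fourier coefficients of \<open>F\<close> are limits of
  truncated Fourier integrals of \<open>sinc^k\<close>. These tend to \<open>\<Pi>^{*k}\<close> at every
  point (\<open>nsinc_ft_tendsto\<close>), including the jumps of \<open>\<Pi>\<close>: for \<open>k = 1\<close> this is the Dirichlet integral, and since
  \<open>sinc\<close> is the Fourier transform of \<open>\<Pi>\<close>, an additional factor \<open>sinc\<close> convolves the
  truncated integrals with \<open>\<Pi>\<close>, so dominated convergence carries the limit from \<open>k\<close> to \<open>k + 1\<close>.
  Finally \<open>F\<close> is continuous and \<open>T\<close>-periodic, and such a function is determined by its Fourier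
  coefficients (\<open>orthogonal_to_characters_eq_0\<close>).

  Both ranges of summation agree for \<open>k \<ge> 2\<close> because \<open>\<Pi>^{*k}\<close> then vanishes at \<open>\<plusminus>k/2\<close>.
\<close>

section \<open>The Fourier transform of powers of the cardinal sine\<close>

lemma nsinc_eq_sinc: "nsinc x = sinc (pi * x)"
  by (simp add: nsinc_def)

lemma continuous_on_nsinc [continuous_intros]:
  "continuous_on S f \<Longrightarrow> continuous_on S (\<lambda>x. nsinc (f x))"
  unfolding nsinc_eq_sinc by (intro continuous_intros) 

lemma nsinc_minus [simp]: "nsinc (- x) = nsinc x"
  by (simp add: nsinc_def)

lemma abs_nsinc_le_1: "\<bar>nsinc x\<bar> \<le> 1"
  using abs_sin_x_le_abs_x[of "pi * x"] by (auto simp: nsinc_def abs_mult divide_le_eq_1)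

lemma abs_nsinc_le_inverse: "x \<noteq> 0 \<Longrightarrow> \<bar>nsinc x\<bar> \<le> 1 / \<bar>x\<bar>"
proof -
  assume x: "x \<noteq> 0"
  have "\<bar>sin (pi * x)\<bar> \<le> pi"
    using abs_sin_le_one[of "pi * x"] pi_gt3 by linarith
  then have "\<bar>sin (pi * x)\<bar> / (pi * \<bar>x\<bar>) \<le> pi / (pi * \<bar>x\<bar>)"
    using x by (intro divide_right_mono) auto
  then show ?thesis using x by (simp add: nsinc_def abs_mult)
qed

text \<open>
  The truncation to \<open>{-R..R}\<close> makes every integral proper, so that \<open>k = 1\<close>, where the integral
  over the line converges only conditionally, is treated like the other exponents. The sine part of the transform is
  absent because \<open>nsinc\<close> is even.
\<close>

definition nsinc_ft :: "nat \<Rightarrow> real \<Rightarrow> real \<Rightarrow> real" where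
  "nsinc_ft k R s = integral {-R..R} (\<lambda>x. nsinc x ^ k * cos (2 * pi * x * s))"

text \<open>
  The product formula for \<open>sin \<cdot> cos\<close> splits the integrand into two scaled copies of the unnormalized
  \<open>sinc\<close>, whose antiderivative is \<open>Si\<close>.
\<close>

lemma nsinc_ft_1:
  assumes "R \<ge> 0"
  shows "nsinc_ft 1 R s = (Si (pi * (1 + 2 * s) * R) + Si (pi * (1 - 2 * s) * R)) / pi"
proof -
  define F where "F = (\<lambda>x. (Si (pi * (1 + 2 * s) * x) + Si (pi * (1 - 2 * s) * x)) / (2 * pi))"
  have DERIV_Si_scaled: "((\<lambda>x. Si (c * x)) has_real_derivative sinc (c * x) * c) (at x)" for c x
    by (rule DERIV_chain2[OF DERIV_Si]) (auto intro!: derivative_eq_intros)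
  have "((\<lambda>x. nsinc x ^ 1 * cos (2 * pi * x * s)) has_integral F R - F (- R)) {-R..R}"
  proof (rule fundamental_theorem_of_calculus)
    fix x :: real
    have "(F has_real_derivative
       (sinc (pi * (1 + 2 * s) * x) * (pi * (1 + 2 * s)) + sinc (pi * (1 - 2 * s) * x) * (pi * (1 - 2 * s)))
          / (2 * pi)) (at x)"
      unfolding F_def using DERIV_Si_scaled
      by (intro DERIV_cdivide DERIV_add)
    also have "(sinc (pi * (1 + 2 * s) * x) * (pi * (1 + 2 * s)) + sinc (pi * (1 - 2 * s) * x) * (pi * (1 - 2 * s)))
          / (2 * pi) = nsinc x ^ 1 * cos (2 * pi * x * s)"
    proof (cases "x = 0")
      case True
      then show ?thesis by (simp add: nsinc_def field_simps)
    next
      case False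
      have *: "sinc (pi * a * x) * (pi * a) = sin (pi * a * x) / x" for a
        using False by auto
      have 1: "sin (pi * (1 + 2 * s) * x) = sin (pi * x) * cos (2 * pi * x * s) + cos (pi * x) * sin (2 * pi * x * s)"
        by (subst sin_add[symmetric]) (simp add: algebra_simps)
      have 2: "sin (pi * (1 - 2 * s) * x) = sin (pi * x) * cos (2 * pi * x * s) - cos (pi * x) * sin (2 * pi * x * s)"
        by (subst sin_diff[symmetric]) (simp add: algebra_simps)
      show ?thesis unfolding * unfolding 1 2 using False by (simp add: nsinc_def field_simps)
    qed
    finally show "(F has_vector_derivative nsinc x ^ 1 * cos (2 * pi * x * s)) (at x within {-R..R})"
      using has_field_derivative_at_within has_real_derivative_iff_has_vector_derivative by blast
  qed (use assms in simp)
  then have "nsinc_ft 1 R s = F R - F (- R)"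
    unfolding nsinc_ft_def by (rule integral_unique)
  moreover have Si_odd: "Si (- t) = - Si t" for t
    using Si_neg[of t] Si_neg[of "- t"] by (cases "t \<ge> 0") auto
  ultimately show ?thesis
    unfolding F_def mult_minus_right Si_odd by (simp add: add_divide_distrib diff_divide_distrib)
qed

lemma continuous_on_nsinc_ft: "continuous_on UNIV (nsinc_ft k R)"
proof -
  have "continuous_on UNIV (\<lambda>s. integral (cbox (-R) R) (\<lambda>x. nsinc x ^ k * cos (2 * pi * x * s)))"
    by (rule integral_continuous_on_param) (auto simp: case_prod_beta intro!: continuous_intros)
  then show ?thesis by (simp add: nsinc_ft_def[abs_def])
qed

lemma nsinc_eq_integral_cos:
  "integral {-1/2..1/2} (\<lambda>t. cos (2 * pi * x * (s - t))) = nsinc x * cos (2 * pi * x * s)"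
proof (cases "x = 0")
  case True
  then show ?thesis by (simp add: nsinc_def)
next
  case False
  define F where "F = (\<lambda>t. - sin (2 * pi * x * (s - t)) / (2 * pi * x))"
  have "((\<lambda>t. cos (2 * pi * x * (s - t))) has_integral F (1/2) - F (-1/2)) {-1/2..1/2}"
  proof (rule fundamental_theorem_of_calculus)
    fix t :: real
    have "(F has_real_derivative cos (2 * pi * x * (s - t))) (at t)"
      unfolding F_def using False
      by (auto intro!: derivative_eq_intros simp: field_simps)
    then show "(F has_vector_derivative cos (2 * pi * x * (s - t))) (at t within {-1/2..1/2})"
      using has_field_derivative_at_within has_real_derivative_iff_has_vector_derivative by blast
  qed simp
  moreover have "F (1/2) - F (-1/2) = nsinc x * cos (2 * pi * x * s)"
  proof -
    have 1: "sin (2 * pi * x * (s - 1/2)) = sin (2 * pi * x * s) * cos (pi * x) - cos (2 * pi * x * s) * sin (pi * x)"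
      by (subst sin_diff[symmetric]) (simp add: algebra_simps)
    have 2: "sin (2 * pi * x * (s - (- 1/2))) = sin (2 * pi * x * s) * cos (pi * x) + cos (2 * pi * x * s) * sin (pi * x)"
      by (subst sin_add[symmetric]) (simp add: algebra_simps)
    show ?thesis
      unfolding F_def 1 2 using False by (simp add: nsinc_def field_simps)
  qed
  ultimately show ?thesis by (simp add: integral_unique)
qed

text \<open>
  One factor \<open>nsinc\<close> is replaced by its representation as an integral over \<open>{-1/2..1/2}\<close>. The
  integrand is jointly continuous on a rectangle, so the order of integration may be exchanged.
\<close>

lemma nsinc_ft_Suc:
  "nsinc_ft (Suc k) R s = integral {-1/2..1/2} (\<lambda>t. nsinc_ft k R (s - t))"
proof -
  have "nsinc_ft (Suc k) R s =
     integral (cbox (-R) R) (\<lambda>x. integral (cbox (-1/2) (1/2)) (\<lambda>t. nsinc x ^ k * cos (2 * pi * x * (s - t))))"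
    unfolding nsinc_ft_def box_real integral_mult_right nsinc_eq_integral_cos
    by (simp add: mult_ac)
  also have "\<dots> = integral (cbox (-1/2) (1/2)) (\<lambda>t. integral (cbox (-R) R) (\<lambda>x. nsinc x ^ k * cos (2 * pi * x * (s - t))))"
    by (rule integral_swap_continuous) (auto simp: case_prod_beta intro!: continuous_intros)
  finally show ?thesis by (simp add: nsinc_ft_def)
qed

lemma borel_measurable_nsinc_ft [measurable]: "nsinc_ft k R \<in> borel_measurable borel"
  by (intro borel_measurable_continuous_onI continuous_on_nsinc_ft)

lemma borel_measurable_rect [measurable]: "rect \<in> borel_measurable borel"
  unfolding rect_def[abs_def] by measurable

lemma AE_rect: "AE y in lebesgue. rect y = indicator {-1/2..1/2} y"
  using AE_completion[OF AE_lborel_singleton[of "1/2"]] AE_completion[OF AE_lborel_singleton[of "-1/2"]]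
  by eventually_elim (auto simp: rect_def indicator_def abs_if split: if_splits)

lemma nsinc_ft_Suc_LINT:
  "nsinc_ft (Suc k) R s = (LINT t|lebesgue. rect t * nsinc_ft k R (s - t))"
proof -
  have "(\<lambda>t. nsinc_ft k R (s - t)) absolutely_integrable_on {-1/2..1/2}"
    by (intro absolutely_integrable_continuous_real continuous_on_compose2[OF continuous_on_nsinc_ft] continuous_intros) auto
  then have "nsinc_ft (Suc k) R s = (LINT t:{-1/2..1/2}|lebesgue. nsinc_ft k R (s - t))"
    by (simp add: nsinc_ft_Suc set_lebesgue_integral_eq_integral)
  also have "\<dots> = (LINT t|lebesgue. rect t * nsinc_ft k R (s - t))"
    unfolding set_lebesgue_integral_def
  proof (rule integral_cong_AE)
    show "(\<lambda>t. indicator {-1/2..1/2::real} t *\<^sub>R nsinc_ft k R (s - t)) \<in> borel_measurable lebesgue"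
      by (rule measurable_completion) measurable
    show "(\<lambda>t. rect t * nsinc_ft k R (s - t)) \<in> borel_measurable lebesgue"
      by (rule measurable_completion) measurable
    show "AE t in lebesgue. indicator {-1/2..1/2} t *\<^sub>R nsinc_ft k R (s - t) = rect t * nsinc_ft k R (s - t)"
      using AE_rect by eventually_elim simp
  qed
  finally show ?thesis .
qed

text \<open>
  A bound uniform in both \<open>R\<close> and \<open>s\<close> is what dominated convergence needs in
  \<open>nsinc_ft_tendsto\<close>. It comes from the boundedness of \<open>Si\<close> and is inherited by larger \<open>k\<close>, since
  \<open>nsinc_ft_Suc\<close> averages over an interval of length 1.
\<close>

lemma nsinc_ft_bounded: "k \<ge> 1 \<Longrightarrow> \<exists>B. \<forall>R\<ge>0. \<forall>s. \<bar>nsinc_ft k R s\<bar> \<le> B"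
proof (induction k rule: dec_induct)
  case base
  obtain B where B: "\<bar>Si t\<bar> \<le> B" for t using bounded_Si by blast
  have "\<bar>nsinc_ft 1 R s\<bar> \<le> (B + B) / pi" if "R \<ge> 0" for R s
    unfolding nsinc_ft_1[OF that] abs_divide
    using B[of "pi * (1 + 2 * s) * R"] B[of "pi * (1 - 2 * s) * R"]
    by (auto intro!: divide_right_mono)
  then show ?case by auto
next
  case (step k)
  then obtain B where B: "\<And>R s. R \<ge> 0 \<Longrightarrow> \<bar>nsinc_ft k R s\<bar> \<le> B" by auto
  have "\<bar>nsinc_ft (Suc k) R s\<bar> \<le> B" if "R \<ge> 0" for R s
  proof -
    have "norm (integral {-1/2..1/2} (\<lambda>t. nsinc_ft k R (s - t))) \<le> B * (1/2 - (-1/2))"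
      by (rule integral_bound) (use B[OF that] in \<open>auto intro!: continuous_on_compose2[OF continuous_on_nsinc_ft] continuous_intros\<close>)
    then show ?thesis by (simp add: nsinc_ft_Suc)
  qed
  then show ?case by blast
qed

lemma conv_power_Suc:
  "k \<ge> 1 \<Longrightarrow> conv_power f (Suc k) s = (LINT y|lebesgue. f y * conv_power f k (s - y))"
  by (cases k) (auto simp: conv_power_def fun_conv_def)

lemma tendsto_Si_scaled: "((\<lambda>R. Si (c * R)) \<longlongrightarrow> sgn c * (pi / 2)) at_top"
proof -
  have pos: "((\<lambda>R. Si (c * R)) \<longlongrightarrow> pi / 2) at_top" if "c > 0" for c
    by (rule filterlim_compose[OF Si_at_top])
       (use that in \<open>intro filterlim_tendsto_pos_mult_at_top[OF tendsto_const] filterlim_ident\<close>)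
  have "((\<lambda>R. - Si (- c * R)) \<longlongrightarrow> sgn c * (pi / 2)) at_top" if "c < 0"
    using pos[of "- c"] that by (auto intro!: tendsto_eq_intros)
  moreover have "Si (- t) = - Si t" for t
    using Si_neg[of t] Si_neg[of "- t"] by (cases "t \<ge> 0") auto
  moreover have "Si 0 = 0" by (simp add: Si_alt_def zero_ereal_def)
  ultimately show ?thesis using pos[of c] by (cases c "0::real" rule: linorder_cases) auto
qed

text \<open>
  For \<open>k = 1\<close> the limit is \<open>(sgn (1 + 2s) + sgn (1 - 2s)) / 2\<close>, which at \<open>s = \<plusminus>1/2\<close>
  equals \<open>1/2\<close>, the value of \<open>rect\<close> at its jumps.
\<close>

lemma nsinc_ft_tendsto:
  "k \<ge> 1 \<Longrightarrow> ((\<lambda>R. nsinc_ft k R s) \<longlongrightarrow> conv_power rect k s) at_top"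
proof (induction k arbitrary: s rule: dec_induct)
  case base
  have "((\<lambda>R. (Si (pi * (1 + 2 * s) * R) + Si (pi * (1 - 2 * s) * R)) / pi)
      \<longlongrightarrow> (sgn (pi * (1 + 2 * s)) * (pi / 2) + sgn (pi * (1 - 2 * s)) * (pi / 2)) / pi) at_top"
    by (intro tendsto_intros tendsto_Si_scaled) auto
  also have "(sgn (pi * (1 + 2 * s)) * (pi / 2) + sgn (pi * (1 - 2 * s)) * (pi / 2)) / pi = conv_power rect 1 s"
    using pi_gt_zero by (auto simp: conv_power_def rect_def sgn_mult sgn_if abs_if zero_less_mult_iff)
  finally show ?case
    by (rule Lim_transform_eventually) (use eventually_ge_at_top[of 0] in eventually_elim, simp only: nsinc_ft_1)
next
  case (step k)
  obtain B where B: "\<And>R s. R \<ge> 0 \<Longrightarrow> \<bar>nsinc_ft k R s\<bar> \<le> B"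
    using nsinc_ft_bounded[OF step.hyps(1)] by blast
  have [measurable]: "conv_power rect k \<in> borel_measurable borel"
  proof (rule borel_measurable_LIMSEQ_metric)
    show "(\<lambda>n. nsinc_ft k (real n) s) \<longlonglongrightarrow> conv_power rect k s" for s
      by (rule filterlim_compose[OF step.IH filterlim_real_sequentially])
  qed simp
  have "((\<lambda>R. LINT t|lebesgue. rect t * nsinc_ft k R (s - t)) \<longlongrightarrow> 
          (LINT t|lebesgue. rect t * conv_power rect k (s - t))) at_top"
  proof (rule integral_dominated_convergence_at_top)
    show "integrable lebesgue (\<lambda>t. indicator {-1/2..1/2::real} t * B)"
      by (intro integrable_mult_left integrable_real_indicator) (auto )
    show "\<forall>\<^sub>F R in at_top. AE t in lebesgue. norm (rect t * nsinc_ft k R (s - t)) \<le> indicator {-1/2..1/2} t * B"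
      using eventually_ge_at_top[of 0]
    proof eventually_elim
      case (elim R)
      have "B \<ge> 0" using B[OF elim, of 0] by linarith
      then have "norm (rect t * nsinc_ft k R (s - t)) \<le> indicator {-1/2..1/2} t * B" for t
        using B[OF elim, of "s - t"] by (auto simp: rect_def indicator_def abs_mult abs_if split: if_splits)
      then show ?case by simp
    qed
    show "AE t in lebesgue. ((\<lambda>R. rect t * nsinc_ft k R (s - t)) \<longlongrightarrow> rect t * conv_power rect k (s - t)) at_top"
      by (intro AE_I2 tendsto_intros step.IH)
    show "(\<lambda>t. rect t * conv_power rect k (s - t)) \<in> borel_measurable lebesgue"
      by (rule measurable_completion) measurable
    show "(\<lambda>t. rect t * nsinc_ft k R (s - t)) \<in> borel_measurable lebesgue" for R
      by (rule measurable_completion) measurable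
  qed
  then show ?case
    using step.hyps by (simp add: nsinc_ft_Suc_LINT conv_power_Suc)
qed

text \<open>
  The support of \<open>\<Pi>^{*k}\<close> lies in \<open>{-k/2..k/2}\<close>. From \<open>k = 2\<close> on the end points are excluded as well:
  at \<open>|s| = (k + 1)/2\<close> the integrand of the convolution can be nonzero only for \<open>y = \<plusminus>1/2\<close>, a null set.
\<close>

lemma conv_power_rect_eq_0:
  assumes "k \<ge> 1" "\<bar>s\<bar> > real k / 2 \<or> (k \<ge> 2 \<and> \<bar>s\<bar> = real k / 2)"
  shows "conv_power rect k s = 0"
  using assms
proof (induction k arbitrary: s rule: dec_induct)
  case base
  then show ?case by (auto simp: conv_power_def rect_def)
next
  case (step k)
  have "AE y in lebesgue. rect y * conv_power rect k (s - y) = 0"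
    using AE_rect AE_completion[OF AE_lborel_singleton[of "1/2"]] AE_completion[OF AE_lborel_singleton[of "-1/2"]]
  proof eventually_elim
    case (elim y)
    show ?case
    proof (cases "\<bar>y\<bar> < 1/2")
      case True
      moreover have "\<bar>s\<bar> \<ge> (real k + 1) / 2" using step.prems by auto
      ultimately have "\<bar>s - y\<bar> > real k / 2" by (simp add: abs_if split: if_splits)
      then show ?thesis using step.IH by simp
    qed (use elim in \<open>auto simp: rect_def abs_if split: if_splits\<close>)
  qed
  then show ?case using step.hyps by (simp add: conv_power_Suc integral_eq_zero_AE)
qed

section \<open>Fourier coefficients determine a continuous periodic function\<close>

lemma continuous_on_character [continuous_intros]:
  "continuous_on S (\<lambda>x. cis (2 * pi * of_int n * x / T))"
  by (cases "T = 0") (auto intro!: continuous_intros)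

text \<open>
  Continuity is part of the predicate so that it is preserved by all the operations below without
  side conditions on integrability.
\<close>

definition orthogonal_to_characters :: "real \<Rightarrow> (real \<Rightarrow> complex) \<Rightarrow> bool" where
  "orthogonal_to_characters T h \<longleftrightarrow> continuous_on UNIV h \<and>
     (\<forall>n::int. integral {-T/2..T/2} (\<lambda>x. cis (2 * pi * n * x / T) * h x) = 0)"

lemma orthogonal_to_characters_add:
  assumes "orthogonal_to_characters T f" "orthogonal_to_characters T g"
  shows "orthogonal_to_characters T (\<lambda>x. f x + g x)"
proof -
  have c: "continuous_on UNIV f" "continuous_on UNIV g"
    using assms by (auto simp: orthogonal_to_characters_def)
  have "(\<lambda>x. cis (2 * pi * n * x / T) * f x) integrable_on {-T/2..T/2}"
    "(\<lambda>x. cis (2 * pi * n * x / T) * g x) integrable_on {-T/2..T/2}" for n :: int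
    using c by (auto intro!: integrable_continuous_real continuous_intros intro: continuous_on_subset)
  then show ?thesis
    using assms c by (auto simp: orthogonal_to_characters_def distrib_left integral_add intro!: continuous_intros)
qed

lemma orthogonal_to_characters_scale:
  "orthogonal_to_characters T f \<Longrightarrow> orthogonal_to_characters T (\<lambda>x. a * f x)"
  by (auto simp: orthogonal_to_characters_def mult.left_commute[of _ a] intro!: continuous_intros)

lemma orthogonal_to_characters_cis:
  assumes "orthogonal_to_characters T f"
  shows "orthogonal_to_characters T (\<lambda>x. cis (2 * pi * of_int m * x / T) * f x)"
proof -
  have "cis (2 * pi * of_int n * x / T) * (cis (2 * pi * of_int m * x / T) * f x) =
      cis (2 * pi * of_int (n + m) * x / T) * f x" for n x
    unfolding mult.assoc[symmetric] cis_mult by (simp add: add_divide_distrib distrib_left distrib_right)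
  then show ?thesis
    using assms unfolding orthogonal_to_characters_def
    by (auto simp only: intro!: continuous_intros)
qed

text \<open>
  The statement ranges over all orthogonal \<open>h\<close>, so that a product of polynomials is handled by applying
  one induction hypothesis to the result of the other.
\<close>

lemma orthogonal_to_characters_polynomial:
  fixes g :: "complex \<Rightarrow> real"
  assumes "real_polynomial_function g" "orthogonal_to_characters T h"
  shows "orthogonal_to_characters T (\<lambda>x. of_real (g (cis (2 * pi * x / T))) * h x)"
  using assms
proof (induction arbitrary: h)
  case (linear f)
  have f: "f z = Re z * f 1 + Im z * f \<i>" for z
  proof -
    have "f z = f (Re z *\<^sub>R 1 + Im z *\<^sub>R \<i>)"
      by (rule arg_cong[where f = f]) (simp add: complex_eq_iff)
    also have "\<dots> = Re z * f 1 + Im z * f \<i>"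
      using linear.hyps by (simp add: linear_simps)
    finally show ?thesis .
  qed
  have *: "of_real (f (cis t)) = of_real (f 1 / 2) * (cis t + cis (- t)) + of_real (- f \<i> / 2) * \<i> * (cis t - cis (- t))" for t
    by (simp add: f[of "cis t"] complex_eq_iff)
  have "orthogonal_to_characters T (\<lambda>x.
      (of_real (f 1 / 2) + of_real (- f \<i> / 2) * \<i>) * (cis (2 * pi * of_int 1 * x / T) * h x) +
      (of_real (f 1 / 2) - of_real (- f \<i> / 2) * \<i>) * (cis (2 * pi * of_int (- 1) * x / T) * h x))"
    by (intro orthogonal_to_characters_add orthogonal_to_characters_scale orthogonal_to_characters_cis linear.prems)
  moreover have "(a + b) * (cis (2 * pi * of_int 1 * x / T) * h x) + (a - b) * (cis (2 * pi * of_int (- 1) * x / T) * h x) =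
      (a * (cis (2 * pi * x / T) + cis (- (2 * pi * x / T))) +
       b * (cis (2 * pi * x / T) - cis (- (2 * pi * x / T)))) * h x" for a b x
    by (simp add: ring_distribs mult.assoc)
  ultimately show ?case by (simp only: *)
next
  case (const c)
  then show ?case by (rule orthogonal_to_characters_scale)
next
  case (add f g)
  show ?case
    using orthogonal_to_characters_add[OF add.IH(1)[OF add.prems] add.IH(2)[OF add.prems]]
    by (simp add: distrib_right)
next
  case (mult f g)
  show ?case using mult.IH(1)[OF mult.IH(2)[OF mult.prems]] by (simp add: mult.assoc)
qed

lemma periodic_int_multiple:
  fixes h :: "real \<Rightarrow> 'a"
  assumes "\<And>x. h (x + T) = h x"
  shows "h (x + of_int m * T) = h x"
proof (induction m rule: int_induct[where k = 0])
  case (step1 i)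
  then show ?case using assms[of "x + of_int i * T"] by (simp add: algebra_simps)
next
  case (step2 i)
  then show ?case using assms[of "x + of_int (i - 1) * T"] by (simp add: algebra_simps)
qed simp

text \<open>
  Stone-Weierstrass requires a compact domain on which the characters separate points. That is the
  circle, not the period interval, whose end points the characters identify.
\<close>

lemma continuous_on_circle_of_periodic:
  fixes h :: "real \<Rightarrow> complex"
  assumes T: "T > 0" and per: "\<And>x. h (x + T) = h x" and cont: "continuous_on UNIV h"
  obtains H where "continuous_on (sphere 0 1) H" "\<And>x. H (cis (2 * pi * x / T)) = h x"
proof
  define H where "H = (\<lambda>z. h (T * Arg z / (2 * pi)))"
  have eqI: "h (T * a / (2 * pi)) = h (T * b / (2 * pi))" if "cis a = cis b" for a b
  proof -
    from that have "sin a = sin b \<and> cos a = cos b" by (simp add: complex_eq_iff)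
    then obtain m :: int where "a = b + 2 * pi * m" 
      by (auto simp: sin_cos_eq_iff)
    then have "T * a / (2 * pi) = T * b / (2 * pi) + of_int m * T"
      by (simp add: field_simps)
    then show ?thesis using periodic_int_multiple[of h T, OF per] by simp
  qed
  show "H (cis (2 * pi * x / T)) = h x" for x
    using eqI[of "Arg (cis (2 * pi * x / T))" "2 * pi * x / T"] T
    by (simp add: H_def cis_Arg sgn_if)
  show "continuous_on (sphere 0 1) H"
    unfolding continuous_on_def
  proof
    fix z0 :: complex assume "z0 \<in> sphere 0 1"
    then have z0: "norm z0 = 1" by simp
    then have "z0 \<noteq> 0" by auto
    \<comment> \<open>\<open>Arg\<close> jumps on the negative real axis. Near \<open>z0\<close> the branch \<open>Arg z0 + Arg (z / z0)\<close> is
      continuous, and it differs from \<open>Arg z\<close> by a multiple of \<open>2 \<pi>\<close>, to which \<open>h\<close> is blind.\<close>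
    have "isCont Arg (1::complex)" by (rule continuous_at_Arg) simp
    moreover have "((\<lambda>z. z / z0) \<longlongrightarrow> z0 / z0) (at z0 within sphere 0 1)"
      using \<open>z0 \<noteq> 0\<close> by (intro tendsto_intros)
    then have "((\<lambda>z. z / z0) \<longlongrightarrow> 1) (at z0 within sphere 0 1)"
      using \<open>z0 \<noteq> 0\<close> by simp
    ultimately have Arg_lim: "((\<lambda>z. Arg (z / z0)) \<longlongrightarrow> Arg 1) (at z0 within sphere 0 1)"
      by (rule isCont_tendsto_compose)
    have "((\<lambda>z. T * (Arg z0 + Arg (z / z0)) / (2 * pi)) \<longlongrightarrow> T * (Arg z0 + Arg 1) / (2 * pi)) (at z0 within sphere 0 1)"
      by (intro tendsto_mult tendsto_add tendsto_divide tendsto_const Arg_lim) simp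
    then have "((\<lambda>z. T * (Arg z0 + Arg (z / z0)) / (2 * pi)) \<longlongrightarrow> T * Arg z0 / (2 * pi)) (at z0 within sphere 0 1)"
      by simp
    moreover have "isCont h (T * Arg z0 / (2 * pi))" 
      using cont by (simp add: continuous_on_eq_continuous_at)
    ultimately have "((\<lambda>z. h (T * (Arg z0 + Arg (z / z0)) / (2 * pi))) \<longlongrightarrow> H z0) (at z0 within sphere 0 1)"
      unfolding H_def by (rule isCont_tendsto_compose[rotated])
    moreover have "\<forall>\<^sub>F z in at z0 within sphere 0 1. h (T * (Arg z0 + Arg (z / z0)) / (2 * pi)) = H z"
      unfolding eventually_at_filter
    proof (intro always_eventually allI impI)
      fix z :: complex assume "z \<in> sphere 0 1"
      then have z: "norm z = 1" by simp
      then have "z \<noteq> 0" by auto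
      have "cis (Arg z0 + Arg (z / z0)) = z" "cis (Arg z) = z"
        using z0 z \<open>z0 \<noteq> 0\<close> \<open>z \<noteq> 0\<close> 
        by (simp_all add: cis_mult[symmetric] cis_Arg sgn_eq norm_divide)
      then show "h (T * (Arg z0 + Arg (z / z0)) / (2 * pi)) = H z"
        unfolding H_def by (intro eqI) simp
    qed
    ultimately show "(H \<longlongrightarrow> H z0) (at z0 within sphere 0 1)"
      by (rule Lim_transform_eventually)
  qed
qed

text \<open>
  Uniform approximation of the conjugate of \<open>h\<close> by trigonometric polynomials, to which \<open>h\<close> is
  orthogonal, makes the integral of \<open>|h|\<^sup>2\<close> arbitrarily small.
\<close>

lemma orthogonal_to_characters_eq_0:
  assumes T: "T > 0" and per: "\<And>x. h (x + T) = h x" and orth: "orthogonal_to_characters T h"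
    and x: "x \<in> {-T/2..T/2}"
  shows "h x = 0"
proof -
  have cont: "continuous_on S h" for S
    using orth by (auto simp: orthogonal_to_characters_def intro: continuous_on_subset)
  obtain H where H: "continuous_on (sphere 0 1) H" "\<And>x. H (cis (2 * pi * x / T)) = h x"
    using continuous_on_circle_of_periodic[OF T per cont] by blast
  define I where "I = integral {-T/2..T/2} (\<lambda>x. cnj (h x) * h x)"
  obtain B where B: "\<And>x. x \<in> {-T/2..T/2} \<Longrightarrow> norm (h x) \<le> B" "B > 0"
  proof -
    have "bounded (h ` {-T/2..T/2})"
      by (intro compact_imp_bounded compact_continuous_image cont compact_Icc)
    then obtain b where "b > 0" "\<forall>y\<in>h ` {-T/2..T/2}. norm y \<le> b" 
      unfolding bounded_pos by blast
    then show ?thesis using that[of b] by blast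
  qed
  have "norm I \<le> e * (B * T)" if e: "e > 0" for e
  proof -
    obtain g where g: "polynomial_function g" "\<And>z. z \<in> sphere 0 1 \<Longrightarrow> norm (cnj (H z) - g z) < e"
      using Stone_Weierstrass_polynomial_function[of "sphere 0 1" "\<lambda>z. cnj (H z)" e] H(1) e
      by (auto intro: continuous_intros)
    define G where "G = (\<lambda>x. g (cis (2 * pi * x / T)))"
    have "real_polynomial_function (\<lambda>z. Re (g z))" "real_polynomial_function (\<lambda>z. Im (g z))"
      using g(1) bounded_linear_Re bounded_linear_Im by (auto simp: polynomial_function_def o_def)
    then have "orthogonal_to_characters T (\<lambda>x. of_real (Re (G x)) * h x + \<i> * (of_real (Im (G x)) * h x))"
      unfolding G_def
      by (intro orthogonal_to_characters_add orthogonal_to_characters_scale 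
           orthogonal_to_characters_polynomial[of "\<lambda>z. Re (g z)"]
           orthogonal_to_characters_polynomial[of "\<lambda>z. Im (g z)"] orth)
    moreover have "of_real (Re (G x)) * h x + \<i> * (of_real (Im (G x)) * h x) = G x * h x" for x
      by (simp add: complex_eq_iff)
    ultimately have G: "orthogonal_to_characters T (\<lambda>x. G x * h x)" by simp
    then have contG: "continuous_on S (\<lambda>x. G x * h x)" for S
      by (auto simp: orthogonal_to_characters_def intro: continuous_on_subset)
    from G have "integral {-T/2..T/2} (\<lambda>x. cis (2 * pi * of_int 0 * x / T) * (G x * h x)) = 0"
      unfolding orthogonal_to_characters_def by blast
    then have "integral {-T/2..T/2} (\<lambda>x. G x * h x) = 0" by simp
    then have "I = integral {-T/2..T/2} (\<lambda>x. cnj (h x) * h x - G x * h x)"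
      unfolding I_def
      by (subst integral_diff) (auto intro!: integrable_continuous_real continuous_intros cont contG)
    also have "norm \<dots> \<le> (e * B) * (T/2 - (-T/2))"
    proof (rule integral_bound)
      fix x assume x: "x \<in> {-T/2..T/2}"
      have "norm (cnj (h x) - G x) \<le> e"
        using g(2)[of "cis (2 * pi * x / T)"] by (simp add: H(2) G_def)
      then have "norm ((cnj (h x) - G x) * h x) \<le> e * B"
        unfolding norm_mult using B(1)[OF x] e by (intro mult_mono) auto
      then show "norm (cnj (h x) * h x - G x * h x) \<le> e * B" by (simp add: algebra_simps)
    qed (use T in \<open>auto intro!: continuous_intros cont contG\<close>)
    finally show ?thesis by simp
  qed
  note bound = this
  have "norm I \<le> 0 + d" if "d > 0" for d
    using bound[of "d / (B * T)"] that B(2) T by simp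
  then have I: "norm I \<le> 0" by (rule field_le_epsilon)
  have "integral {-T/2..T/2} (\<lambda>x. (norm (h x))\<^sup>2) = integral {-T/2..T/2} (Re \<circ> (\<lambda>x. cnj (h x) * h x))"
    by (intro integral_cong) (subst cmod_power2, simp add: power2_eq_square)
  also have "\<dots> = Re I"
    unfolding I_def
    by (intro integral_linear integrable_continuous_real continuous_intros cont bounded_linear_Re)
  finally have "integral {-T/2..T/2} (\<lambda>x. (norm (h x))\<^sup>2) = 0"
    using I by simp
  moreover have "continuous_on {-T/2..T/2} (\<lambda>x. (norm (h x))\<^sup>2)"
    by (intro continuous_intros cont)
  ultimately have "(norm (h x))\<^sup>2 = 0"
    using integral_eq_0_iff[of "-T/2" "T/2" "\<lambda>x. (norm (h x))\<^sup>2"] T x by simp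
  then show ?thesis by simp
qed

section \<open>Convergence of the periodization\<close>

text \<open>
  The translates by \<open>jT\<close> and \<open>-jT\<close> are kept together: for \<open>f = nsinc\<close> the one-sided sums can diverge.
\<close>

definition periodization :: "(real \<Rightarrow> real) \<Rightarrow> real \<Rightarrow> nat \<Rightarrow> real \<Rightarrow> real" where
  "periodization f T N x = f x + (\<Sum>j<N. f (x + real (Suc j) * T) + f (x - real (Suc j) * T))"

text \<open>
  Multiplication by \<open>2 sin (\<theta>/2)\<close> makes the numerators telescope, and summation by parts leaves an
  absolutely convergent series. If \<open>sin (\<theta>/2) = 0\<close>, every term vanishes.
\<close>

lemma summable_sin_over_n: "summable (\<lambda>j. sin (real (Suc j) * \<theta>) / real (Suc j))"
proof (cases "sin (\<theta> / 2) = 0")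
  case True
  then obtain m :: int where m: "\<theta> / 2 = of_int m * pi" by (auto simp: sin_zero_iff_int2)
  have "sin (real (Suc j) * \<theta>) = 0" for j
  proof -
    have "real (Suc j) * \<theta> = of_int (2 * int (Suc j) * m) * pi" using m by simp
    then show ?thesis by (metis sin_zero_iff_int2)
  qed
  then show ?thesis by simp
next
  case False
  define C where "C = (\<lambda>j. cos ((real j + 1/2) * \<theta>))"
  have C: "2 * sin (\<theta> / 2) * sin (real (Suc j) * \<theta>) = C j - C (Suc j)" for j
  proof -
    have "C j = cos (real (Suc j) * \<theta> - \<theta> / 2)" "C (Suc j) = cos (real (Suc j) * \<theta> + \<theta> / 2)"
      by (simp_all add: C_def algebra_simps)
    then show ?thesis by (simp add: cos_diff cos_add)
  qed
  define D where "D = (\<lambda>j. C j / real (Suc j))"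
  have "D \<longlonglongrightarrow> 0"
  proof (rule Lim_null_comparison)
    show "\<forall>\<^sub>F j in sequentially. norm (D j) \<le> inverse (real (Suc j))"
      unfolding D_def C_def real_norm_def abs_divide inverse_eq_divide
      by (intro always_eventually allI frac_le) auto
  qed (rule LIMSEQ_inverse_real_of_nat)
  then have 1: "summable (\<lambda>j. D j - D (Suc j))" by (rule telescope_summable')
  have 2: "summable (\<lambda>j. C (Suc j) * (1 / real (Suc j) - 1 / real (Suc (Suc j))))"
  proof (rule summable_comparison_test)
    have "norm (C (Suc j) * (1 / real (Suc j) - 1 / real (Suc (Suc j)))) \<le> 1 / real (Suc j) - 1 / real (Suc (Suc j))" for j
    proof -
      have "1 / real (Suc j) - 1 / real (Suc (Suc j)) \<ge> 0" by (simp add: field_simps)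
      then show ?thesis
        by (auto simp: abs_mult C_def intro!: mult_left_le_one_le)
    qed
    then show "\<exists>N. \<forall>n\<ge>N. norm (C (Suc n) * (1 / real (Suc n) - 1 / real (Suc (Suc n)))) \<le> 1 / real (Suc n) - 1 / real (Suc (Suc n))"
      by blast
    have "(\<lambda>j. 1 / real (Suc j)) \<longlonglongrightarrow> 0"
      using LIMSEQ_inverse_real_of_nat by (simp add: inverse_eq_divide)
    then show "summable (\<lambda>j. 1 / real (Suc j) - 1 / real (Suc (Suc j)))"
      by (rule telescope_summable')
  qed
  have "summable (\<lambda>j. (D j - D (Suc j) - C (Suc j) * (1 / real (Suc j) - 1 / real (Suc (Suc j)))) / (2 * sin (\<theta> / 2)))"
    by (intro summable_divide summable_diff 1 2)
  moreover have "(D j - D (Suc j) - C (Suc j) * (1 / real (Suc j) - 1 / real (Suc (Suc j)))) / (2 * sin (\<theta> / 2))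
      = sin (real (Suc j) * \<theta>) / real (Suc j)" for j
  proof -
    have "D j - D (Suc j) - C (Suc j) * (1 / real (Suc j) - 1 / real (Suc (Suc j))) = (C j - C (Suc j)) / real (Suc j)"
      by (simp add: D_def right_diff_distrib diff_divide_distrib)
    also have "\<dots> = 2 * sin (\<theta> / 2) * (sin (real (Suc j) * \<theta>) / real (Suc j))"
      using C[of j] by simp
    finally show ?thesis using False by simp
  qed
  ultimately show ?thesis by (simp only:)
qed

text \<open>
  By the addition formula the terms of order \<open>1/y\<close> involving \<open>cos (\<pi> y)\<close> cancel between the two
  translates. What remains at this order is a fixed function of \<open>x\<close> times a function of \<open>y\<close>, so its
  sum over \<open>y = jT\<close> converges uniformly in \<open>x\<close> as soon as it converges at all.
\<close>

lemma nsinc_pair_expansion: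
  assumes y: "y > 0" and xy: "\<bar>x\<bar> \<le> M" "2 * M \<le> y"
  shows "\<bar>nsinc (x + y) + nsinc (x - y) - 2 * cos (pi * x) * sin (pi * y) / (pi * y)\<bar> \<le> 4 * M / y\<^sup>2"
proof -
  have n: "x + y \<noteq> 0" "x - y \<noteq> 0" using assms by auto
  \<comment> \<open>The denominator \<open>y\<^sup>2 - x\<^sup>2\<close> is at least \<open>3/4 y\<^sup>2\<close>; the factor \<open>1/\<pi> \<le> 3/4\<close> absorbs this constant.\<close>
  have "\<bar>x\<bar>\<^sup>2 \<le> (y/2)\<^sup>2" using assms by (intro power_mono) auto
  then have x2: "y\<^sup>2 - x\<^sup>2 \<ge> 3/4 * y\<^sup>2" by (simp add: power_divide)
  moreover have y2: "y\<^sup>2 > 0" using y by simp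
  ultimately have n2: "y\<^sup>2 - x\<^sup>2 > 0" by linarith
  define sx cx sy cy where "sx = sin (pi * x)" "cx = cos (pi * x)" "sy = sin (pi * y)" "cy = cos (pi * y)"
  have "nsinc (x + y) + nsinc (x - y) - 2 * cx * sy / (pi * y)
      = ((sx * cy + cx * sy) / (x + y) + (sx * cy - cx * sy) / (x - y) - 2 * cx * sy / y) / pi"
  proof -
    have "sin (pi * (x + y)) = sx * cy + cx * sy" "sin (pi * (x - y)) = sx * cy - cx * sy"
      by (simp_all add: sin_add sin_diff distrib_left right_diff_distrib sx_cx_sy_cy_def)
    then have "nsinc (x + y) = (sx * cy + cx * sy) / (x + y) / pi" "nsinc (x - y) = (sx * cy - cx * sy) / (x - y) / pi"
      using n by (simp_all add: nsinc_def mult.commute)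
    then show ?thesis by (simp add: add_divide_distrib diff_divide_distrib)
  qed
  also have "(sx * cy + cx * sy) / (x + y) + (sx * cy - cx * sy) / (x - y) - 2 * cx * sy / y
      = (2 * x) * (x / y * (cx * sy) - sx * cy) / (y\<^sup>2 - x\<^sup>2)"
  proof -
    have e: "y\<^sup>2 - x\<^sup>2 = - ((x + y) * (x - y))" by (simp add: algebra_simps power2_eq_square)
    show ?thesis unfolding e using n y by (simp add: divide_simps) (simp add: algebra_simps power2_eq_square)
  qed
  also have "\<bar>\<dots> / pi\<bar> \<le> (2 * M * 2) / (3/4 * y\<^sup>2) / pi"
  proof -
    have "\<bar>x / y * (cx * sy) - sx * cy\<bar> \<le> \<bar>x / y\<bar> * (\<bar>cx\<bar> * \<bar>sy\<bar>) + \<bar>sx\<bar> * \<bar>cy\<bar>"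
      using abs_triangle_ineq4[of "x / y * (cx * sy)" "sx * cy"] by (simp add: abs_mult)
    also have "\<dots> \<le> 1 * (1 * 1) + 1 * 1"
      using assms by (intro add_mono mult_mono) (auto simp: sx_cx_sy_cy_def)
    finally have "\<bar>(2 * x) * (x / y * (cx * sy) - sx * cy)\<bar> \<le> (2 * M) * 2"
      unfolding abs_mult using assms by (intro mult_mono) auto
    moreover have "3/4 * y\<^sup>2 \<le> \<bar>y\<^sup>2 - x\<^sup>2\<bar>" using x2 by linarith
    ultimately have "\<bar>(2 * x) * (x / y * (cx * sy) - sx * cy)\<bar> / \<bar>y\<^sup>2 - x\<^sup>2\<bar> \<le> (2 * M * 2) / (3/4 * y\<^sup>2)"
      using y2 assms by (intro frac_le) auto
    then show ?thesis
      unfolding abs_divide[of _ pi] abs_divide[of _ "y\<^sup>2 - x\<^sup>2"] abs_of_pos[OF pi_gt_zero]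
      by (rule divide_right_mono) simp
  qed
  also have "\<dots> = (4 * M / y\<^sup>2) * (4 / 3 / pi)" by simp
  also have "\<dots> \<le> (4 * M / y\<^sup>2) * 1"
    using assms pi_gt3 by (intro mult_left_mono) auto
  finally show ?thesis by (simp add: sx_cx_sy_cy_def)
qed

lemma eventually_Suc_mult_ge:
  assumes "T > (0::real)"
  shows "\<forall>\<^sub>F j in sequentially. real (Suc j) * T \<ge> c"
proof -
  have "filterlim (\<lambda>j. real (Suc j) * T) at_top sequentially"
    by (intro filterlim_at_top_mult_tendsto_pos[OF tendsto_const assms]
          filterlim_compose[OF filterlim_real_sequentially] filterlim_Suc)
  then show ?thesis by (simp add: filterlim_at_top)
qed

lemma summable_inverse_Suc_square: "summable (\<lambda>j. c / (real (Suc j) * T)\<^sup>2)"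
proof -
  have "summable (\<lambda>j. 1 / real (Suc j) ^ 2)"
    using inverse_power_summable[of 2, where 'a = real] by (subst summable_Suc_iff) (simp add: inverse_eq_divide)
  then have "summable (\<lambda>j. (c / T\<^sup>2) * (1 / real (Suc j) ^ 2))" by (rule summable_mult)
  then show ?thesis by (simp add: power_mult_distrib mult.commute)
qed

lemma uniform_limit_periodization_quadratic_decay:
  assumes T: "T > 0" and f: "\<And>y. y \<noteq> 0 \<Longrightarrow> \<bar>f y\<bar> \<le> 1 / y\<^sup>2"
  shows "\<exists>F. \<forall>M. uniform_limit {-M..M} (periodization f T) F sequentially"
proof (intro exI allI)
  fix M :: real
  have "uniform_limit {-M..M} (\<lambda>N x. \<Sum>j<N. f (x + real (Suc j) * T) + f (x - real (Suc j) * T))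
     (\<lambda>x. \<Sum>j. f (x + real (Suc j) * T) + f (x - real (Suc j) * T)) sequentially"
  proof (rule Weierstrass_m_test_ev)
    show "\<forall>\<^sub>F j in sequentially. \<forall>x\<in>{-M..M}.
        norm (f (x + real (Suc j) * T) + f (x - real (Suc j) * T)) \<le> 8 / (real (Suc j) * T)\<^sup>2"
      using eventually_Suc_mult_ge[OF T, of "2 * M"]
    proof eventually_elim
      case (elim j)
      define y where "y = real (Suc j) * T"
      have y: "y > 0" "2 * M \<le> y" using T elim by (auto simp: y_def)
      show ?case
      proof
        fix x assume x: "x \<in> {-M..M}"
        have *: "\<bar>f z\<bar> \<le> 4 / y\<^sup>2" if "\<bar>z\<bar> \<ge> y / 2" for z
        proof -
          have "(y/2)\<^sup>2 \<le> \<bar>z\<bar>\<^sup>2" using that y by (intro power_mono) auto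
          then have "1 / z\<^sup>2 \<le> 1 / (y/2)\<^sup>2" using y by (intro frac_le) auto
          then show ?thesis using f[of z] that y by (cases "z = 0") (auto simp: power_divide)
        qed
        have "\<bar>f (x + y)\<bar> \<le> 4 / y\<^sup>2" "\<bar>f (x - y)\<bar> \<le> 4 / y\<^sup>2"
          using x y by (intro *; simp)+
        then show "norm (f (x + real (Suc j) * T) + f (x - real (Suc j) * T)) \<le> 8 / (real (Suc j) * T)\<^sup>2"
          unfolding y_def[symmetric] by simp
      qed
    qed
  qed (rule summable_inverse_Suc_square)
  then show "uniform_limit {-M..M} (periodization f T)
     (\<lambda>x. f x + (\<Sum>j. f (x + real (Suc j) * T) + f (x - real (Suc j) * T))) sequentially"
    unfolding periodization_def[abs_def]
    by (intro uniform_limit_add uniform_limit_const)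
qed

lemma uniform_limit_periodization_nsinc:
  assumes T: "T > 0"
  shows "\<exists>F. \<forall>M. uniform_limit {-M..M} (periodization nsinc T) F sequentially"
proof (intro exI allI)
  fix M0 :: real
  define M where "M = max 0 M0"
  define s where "s = (\<lambda>j. 2 * sin (real (Suc j) * (pi * T)) / (pi * T * real (Suc j)))"
  define b where "b = (\<lambda>j x. nsinc (x + real (Suc j) * T) + nsinc (x - real (Suc j) * T) - cos (pi * x) * s j)"
  have s: "summable s"
    using summable_mult[OF summable_sin_over_n[of "pi * T"], of "2 / (pi * T)"]
    by (simp add: s_def mult_ac)
  have "uniform_limit {-M..M} (\<lambda>N x. \<Sum>j<N. b j x) (\<lambda>x. \<Sum>j. b j x) sequentially"
  proof (rule Weierstrass_m_test_ev)
    show "\<forall>\<^sub>F j in sequentially. \<forall>x\<in>{-M..M}. norm (b j x) \<le> (4 * M) / (real (Suc j) * T)\<^sup>2"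
      using eventually_Suc_mult_ge[OF T, of "2 * M"]
    proof eventually_elim
      case (elim j)
      show ?case
      proof
        fix x assume "x \<in> {-M..M}"
        then show "norm (b j x) \<le> (4 * M) / (real (Suc j) * T)\<^sup>2"
          using nsinc_pair_expansion[of "real (Suc j) * T" x M] elim T
          by (simp add: b_def s_def abs_le_iff mult_ac)
      qed
    qed
  qed (rule summable_inverse_Suc_square)
  moreover have "uniform_limit {-M..M} (\<lambda>N x. cos (pi * x) * (\<Sum>j<N. s j)) (\<lambda>x. cos (pi * x) * suminf s) sequentially"
  proof (rule uniform_lim_mult[OF uniform_limit_const])
    show "uniform_limit {-M..M} (\<lambda>N x. \<Sum>j<N. s j) (\<lambda>x. suminf s) sequentially"
      using summable_LIMSEQ[OF s] by (auto simp: uniform_limit_iff tendsto_iff)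
    show "bounded ((\<lambda>x. cos (pi * x)) ` {-M..M})"
      by (auto simp: bounded_iff intro!: exI[of _ 1])
  qed (auto simp: bounded_iff)
  ultimately have "uniform_limit {-M..M} (\<lambda>N x. nsinc x + ((\<Sum>j<N. b j x) + cos (pi * x) * (\<Sum>j<N. s j)))
      (\<lambda>x. nsinc x + ((\<Sum>j. b j x) + cos (pi * x) * suminf s)) sequentially"
    by (intro uniform_limit_add uniform_limit_const)
  also have "(\<lambda>N x. nsinc x + ((\<Sum>j<N. b j x) + cos (pi * x) * (\<Sum>j<N. s j))) = periodization nsinc T"
    by (intro ext) (simp add: periodization_def b_def sum_distrib_left sum_subtractf)
  finally show "uniform_limit {-M0..M0} (periodization nsinc T)
      (\<lambda>x. nsinc x + ((\<Sum>j. b j x) + cos (pi * x) * suminf s)) sequentially"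
    by (rule uniform_limit_on_subset) (auto simp: M_def)
qed

lemma abs_nsinc_power_le:
  assumes "k \<ge> 2" "y \<noteq> 0"
  shows "\<bar>nsinc y ^ k\<bar> \<le> 1 / y\<^sup>2"
proof -
  have "\<bar>nsinc y ^ k\<bar> \<le> \<bar>nsinc y\<bar> ^ 2"
    unfolding power_abs using assms abs_nsinc_le_1 by (intro power_decreasing) auto
  also have "\<dots> \<le> (1 / \<bar>y\<bar>) ^ 2"
    using assms abs_nsinc_le_inverse by (intro power_mono) auto
  finally show ?thesis by (simp add: power_divide)
qed

lemma uniform_limit_periodization_nsinc_power:
  assumes T: "T > 0" and k: "k \<ge> 1"
  shows "\<exists>F. \<forall>M. uniform_limit {-M..M} (periodization (\<lambda>x. nsinc x ^ k) T) F sequentially"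
proof (cases "k = 1")
  case True
  then show ?thesis using uniform_limit_periodization_nsinc[OF T] by simp
next
  case False
  with k have "k \<ge> 2" by simp
  then show ?thesis by (intro uniform_limit_periodization_quadratic_decay[OF T] abs_nsinc_power_le)
qed

lemma continuous_on_periodization:
  assumes "continuous_on UNIV f"
  shows "continuous_on S (periodization f T N)"
  unfolding periodization_def[abs_def]
  by (intro continuous_intros continuous_on_compose2[OF assms]) auto

lemma continuous_on_periodization_limit:
  assumes f: "continuous_on UNIV f" and F: "\<And>M. uniform_limit {-M..M} (periodization f T) F sequentially"
  shows "continuous_on UNIV F"
proof -
  have "isCont F x" for x
  proof -
    have "continuous_on {- (\<bar>x\<bar> + 1)..\<bar>x\<bar> + 1} F"
      by (rule uniform_limit_theorem[OF _ F]) (auto intro!: always_eventually continuous_on_periodization[OF f])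
    then show ?thesis
      by (rule continuous_on_interior) (auto simp: abs_if)
  qed
  then show ?thesis by (simp add: continuous_at_imp_continuous_on)
qed

lemma periodization_shift:
  "periodization f T N (x + T) = periodization f T N x + f (x + real (Suc N) * T) - f (x - real N * T)"
  by (induction N) (simp_all add: periodization_def algebra_simps)

text \<open>
  A shift by \<open>T\<close> changes a partial sum only by its two outermost terms, which tend to 0.
\<close>

lemma periodic_periodization_limit:
  assumes T: "T > 0" and F: "\<And>M. uniform_limit {-M..M} (periodization f T) F sequentially"
    and f: "(f \<longlongrightarrow> 0) at_top" "(f \<longlongrightarrow> 0) at_bot"
  shows "F (x + T) = F x"
proof -
  have lim: "(\<lambda>N. periodization f T N x) \<longlonglongrightarrow> F x" for x
    by (rule tendsto_uniform_limitI[OF F[of "\<bar>x\<bar>"]]) auto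
  have mult: "filterlim (\<lambda>N. real N * T) at_top sequentially"
    by (intro filterlim_at_top_mult_tendsto_pos[OF tendsto_const T] filterlim_real_sequentially)
  have "filterlim (\<lambda>N. x + real (Suc N) * T) at_top sequentially"
    by (intro filterlim_tendsto_add_at_top[OF tendsto_const] filterlim_compose[OF mult filterlim_Suc])
  then have 1: "(\<lambda>N. f (x + real (Suc N) * T)) \<longlonglongrightarrow> 0" by (rule filterlim_compose[OF f(1)])
  have "filterlim (\<lambda>N. - x + real N * T) at_top sequentially"
    by (intro filterlim_tendsto_add_at_top[OF tendsto_const] mult)
  then have "filterlim (\<lambda>N. x - real N * T) at_bot sequentially"
    by (simp add: filterlim_uminus_at_top)
  then have 2: "(\<lambda>N. f (x - real N * T)) \<longlonglongrightarrow> 0" by (rule filterlim_compose[OF f(2)])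
  have "(\<lambda>N. periodization f T N x + f (x + real (Suc N) * T) - f (x - real N * T)) \<longlonglongrightarrow> F x + 0 - 0"
    by (intro tendsto_intros lim 1 2)
  then have "(\<lambda>N. periodization f T N (x + T)) \<longlonglongrightarrow> F x"
    by (simp add: periodization_shift)
  with lim[of "x + T"] show ?thesis by (rule LIMSEQ_unique)
qed

section \<open>Integrals against a periodic function\<close>

lemma absolutely_integrable_shift:
  fixes p :: "real \<Rightarrow> 'a::euclidean_space"
  assumes "p absolutely_integrable_on {a..b}"
  shows "(\<lambda>x. p (x + c)) absolutely_integrable_on {a - c..b - c}"
  using assms integrable_shift_real_ivl[of p a b c] integrable_shift_real_ivl[of "\<lambda>x. norm (p x)" a b c]
  by (auto simp: absolutely_integrable_on_def)

lemma periodic_absolutely_integrable: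
  fixes p :: "real \<Rightarrow> 'a::euclidean_space"
  assumes T: "T > 0" and per: "\<And>x. p (x + T) = p x"
    and p: "p absolutely_integrable_on {-T/2..T/2}"
  shows "p absolutely_integrable_on {a..b}"
proof -
  have cell: "p absolutely_integrable_on {-T/2 + of_int m * T..T/2 + of_int m * T}" for m :: int
    using absolutely_integrable_shift[OF p, of "of_int (- m) * T"]
    by (simp only: periodic_int_multiple[of p T, OF per]) simp
  have sym: "p absolutely_integrable_on {-((real N + 1/2) * T)..(real N + 1/2) * T}" for N
  proof (induction N)
    case 0
    then show ?case using p by simp
  next
    case (Suc N)
    have "p absolutely_integrable_on {-((real (Suc N) + 1/2) * T)..-((real N + 1/2) * T)}"
    proof -
      have "- T/2 + of_int (- int (Suc N)) * T = -((real (Suc N) + 1/2) * T)"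
        "T/2 + of_int (- int (Suc N)) * T = -((real N + 1/2) * T)"
        by (simp_all add: field_simps)
      with cell[of "- int (Suc N)"] show ?thesis by (simp only:)
    qed
    moreover have "p absolutely_integrable_on {(real N + 1/2) * T..(real (Suc N) + 1/2) * T}"
    proof -
      have "- T/2 + of_int (int (Suc N)) * T = (real N + 1/2) * T"
        "T/2 + of_int (int (Suc N)) * T = (real (Suc N) + 1/2) * T"
        by (simp_all add: field_simps)
      with cell[of "int (Suc N)"] show ?thesis by (simp only:)
    qed
    moreover have "-((real (Suc N) + 1/2) * T) \<le> -((real N + 1/2) * T)" "-((real N + 1/2) * T) \<le> (real N + 1/2) * T"
      using T by (auto simp: algebra_simps)
    ultimately show ?case
      using absolutely_integrable_on_combine Suc.IH T
      by (meson neg_le_iff_le order_trans)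
  qed
  obtain N where N: "real N * T > \<bar>a\<bar> + \<bar>b\<bar>"
    using reals_Archimedean3[OF T] by blast
  have "{a..b} \<subseteq> {-((real N + 1/2) * T)..(real N + 1/2) * T}"
    using N T by (auto simp: algebra_simps)
  then show ?thesis
    using absolutely_integrable_on_subinterval[OF sym] by blast
qed

lemma absolutely_integrable_continuous_scaleR:
  fixes p :: "real \<Rightarrow> 'a::euclidean_space"
  assumes f: "continuous_on {a..b} f" and p: "p absolutely_integrable_on {a..b}"
  shows "(\<lambda>x. f x *\<^sub>R p x) absolutely_integrable_on {a..b}"
proof (rule absolutely_integrable_bounded_measurable_product[where h = "(*\<^sub>R)" and f = f, OF _ _ _ _ p])
  show "bilinear ((*\<^sub>R) :: real \<Rightarrow> 'a \<Rightarrow> 'a)"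
    by (simp add: bilinear_conv_bounded_bilinear bounded_bilinear_scaleR)
  show "f \<in> borel_measurable (lebesgue_on {a..b})"
    by (rule continuous_imp_measurable_on_sets_lebesgue[OF f]) simp
  show "bounded (f ` {a..b})"
    using compact_continuous_image[OF f] compact_imp_bounded by blast
qed simp

text \<open>
  Shifting each of the \<open>2N + 1\<close> cells of length \<open>T\<close> back to the central one moves the translations
  from the periodic \<open>p\<close> to \<open>f\<close>.
\<close>

lemma integral_eq_integral_periodization:
  fixes p :: "real \<Rightarrow> 'a::euclidean_space"
  assumes T: "T > 0" and per: "\<And>x. p (x + T) = p x"
    and p: "p absolutely_integrable_on {-T/2..T/2}" and f: "continuous_on UNIV f"
  shows "integral {-((real N + 1/2) * T)..(real N + 1/2) * T} (\<lambda>x. f x *\<^sub>R p x) =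
         integral {-T/2..T/2} (\<lambda>x. periodization f T N x *\<^sub>R p x)"
proof (induction N)
  case 0
  then show ?case by (simp add: periodization_def)
next
  case (Suc N)
  define g where "g = (\<lambda>x. f x *\<^sub>R p x)"
  define a where "a = (real N + 1/2) * T"
  have a: "a > 0" "(real (Suc N) + 1/2) * T = a + T" using T by (simp add: a_def, simp add: a_def algebra_simps)
  have pI: "p absolutely_integrable_on {u..v}" for u v
    by (rule periodic_absolutely_integrable[OF T per p])
  have scaled: "(\<lambda>x. h x *\<^sub>R p x) integrable_on {u..v}" if "continuous_on UNIV h" for h u v
    by (intro set_lebesgue_integral_eq_integral(1) absolutely_integrable_continuous_scaleR pI
          continuous_on_subset[OF that]) auto
  have g: "g integrable_on {u..v}" for u v
    unfolding g_def by (rule scaled[OF f])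
  have right: "integral {a..a + T} g = integral {-T/2..T/2} (\<lambda>x. f (x + real (Suc N) * T) *\<^sub>R p x)"
    using integral_shift_real_ivl[of a "real (Suc N) * T" "a + T" g]
      periodic_int_multiple[of p T _ "int (Suc N)", OF per]
    by (simp add: g_def a_def algebra_simps)
  have left: "integral {-(a + T)..-a} g = integral {-T/2..T/2} (\<lambda>x. f (x - real (Suc N) * T) *\<^sub>R p x)"
    using integral_shift_real_ivl[of "-(a + T)" "- (real (Suc N) * T)" "-a" g]
      periodic_int_multiple[of p T _ "- int (Suc N)", OF per]
    by (simp add: g_def a_def algebra_simps)
  have "integral {-(a + T)..a + T} g = integral {-(a + T)..-a} g + (integral {-a..a} g + integral {a..a + T} g)"
  proof -
    have "integral {-(a + T)..-a} g + integral {-a..a + T} g = integral {-(a + T)..a + T} g"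
      "integral {-a..a} g + integral {a..a + T} g = integral {-a..a + T} g"
      using a(1) T by (auto intro!: Henstock_Kurzweil_Integration.integral_combine g)
    then show ?thesis by simp
  qed
  also have "integral {-a..a} g = integral {-T/2..T/2} (\<lambda>x. periodization f T N x *\<^sub>R p x)"
    using Suc.IH by (simp add: g_def a_def)
  also have "integral {-(a + T)..-a} g + (\<dots> + integral {a..a + T} g) =
      integral {-T/2..T/2} (\<lambda>x. f (x - real (Suc N) * T) *\<^sub>R p x +
        (periodization f T N x *\<^sub>R p x + f (x + real (Suc N) * T) *\<^sub>R p x))"
    unfolding left right
    by (subst integral_add, (intro integrable_add scaled continuous_on_periodization[OF f] continuous_on_compose2[OF f] continuous_intros; simp)+)+
       simp
  also have "\<dots> = integral {-T/2..T/2} (\<lambda>x. periodization f T (Suc N) x *\<^sub>R p x)"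
    by (intro integral_cong) (simp add: periodization_def scaleR_add_left)
  finally show ?case unfolding a(2) g_def .
qed

lemma tendsto_integral_uniform_limit_scaleR:
  fixes p :: "real \<Rightarrow> 'a::euclidean_space"
  assumes lim: "uniform_limit {a..b} h F sequentially"
    and h: "\<And>N. continuous_on {a..b} (h N)" and p: "p absolutely_integrable_on {a..b}"
  shows "(\<lambda>N. integral {a..b} (\<lambda>x. h N x *\<^sub>R p x)) \<longlonglongrightarrow> integral {a..b} (\<lambda>x. F x *\<^sub>R p x)"
proof (rule tendstoI)
  fix e :: real assume e: "e > 0"
  define P where "P = integral {a..b} (\<lambda>x. norm (p x))"
  have "P \<ge> 0" unfolding P_def by (rule integral_nonneg) (use p in \<open>auto simp: absolutely_integrable_on_def\<close>)
  have F: "continuous_on {a..b} F"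
    by (rule uniform_limit_theorem[OF _ lim]) (auto simp: h)
  have int: "(\<lambda>x. g x *\<^sub>R p x) integrable_on {a..b}" if "continuous_on {a..b} g" for g
    by (intro set_lebesgue_integral_eq_integral(1) absolutely_integrable_continuous_scaleR p that)
  define d where "d = e / (P + 1)"
  have d: "d > 0" using e \<open>P \<ge> 0\<close> by (simp add: d_def)
  show "\<forall>\<^sub>F N in sequentially. dist (integral {a..b} (\<lambda>x. h N x *\<^sub>R p x)) (integral {a..b} (\<lambda>x. F x *\<^sub>R p x)) < e"
    using uniform_limitD[OF lim d]
  proof eventually_elim
    case (elim N)
    have "integral {a..b} (\<lambda>x. h N x *\<^sub>R p x) - integral {a..b} (\<lambda>x. F x *\<^sub>R p x)
        = integral {a..b} (\<lambda>x. h N x *\<^sub>R p x - F x *\<^sub>R p x)"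
      by (intro integral_diff[symmetric] int h F)
    also have "norm \<dots> \<le> integral {a..b} (\<lambda>x. d * norm (p x))"
    proof (rule integral_norm_bound_integral)
      show "(\<lambda>x. h N x *\<^sub>R p x - F x *\<^sub>R p x) integrable_on {a..b}"
        by (intro integrable_diff int h F)
      show "(\<lambda>x. d * norm (p x)) integrable_on {a..b}"
        using p by (intro integrable_on_mult_right) (auto simp: absolutely_integrable_on_def)
      show "norm (h N x *\<^sub>R p x - F x *\<^sub>R p x) \<le> d * norm (p x)" if "x \<in> {a..b}" for x
      proof -
        have "\<bar>h N x - F x\<bar> \<le> d" using less_imp_le[OF bspec[OF elim that]] by (simp add: dist_real_def)
        then show ?thesis by (simp add: scaleR_diff_left[symmetric] mult_right_mono)
      qed
    qed
    also have "\<dots> = d * P" by (simp add: P_def)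
    also have "\<dots> < e" using e \<open>P \<ge> 0\<close> by (simp add: d_def field_simps)
    finally show ?case by (simp add: dist_norm)
  qed
qed

lemma tendsto_integral_periodization:
  fixes p :: "real \<Rightarrow> 'a::euclidean_space"
  assumes T: "T > 0" and per: "\<And>x. p (x + T) = p x"
    and p: "p absolutely_integrable_on {-T/2..T/2}" and f: "continuous_on UNIV f"
    and F: "\<And>M. uniform_limit {-M..M} (periodization f T) F sequentially"
  shows "(\<lambda>N. integral {-((real N + 1/2) * T)..(real N + 1/2) * T} (\<lambda>x. f x *\<^sub>R p x)) \<longlonglongrightarrow> 
         integral {-T/2..T/2} (\<lambda>x. F x *\<^sub>R p x)"
  unfolding integral_eq_integral_periodization[OF T per p f]
  using tendsto_integral_uniform_limit_scaleR[OF _ continuous_on_periodization[OF f] p] F[of "T/2"]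
  by simp

text \<open>
  The integral equals its own conjugate by the substitution \<open>x \<mapsto> -x\<close>, hence only the cosine part
  survives.
\<close>

lemma integral_nsinc_power_cis:
  "integral {-R..R} (\<lambda>x. nsinc x ^ k *\<^sub>R cis (2 * pi * x * s)) = of_real (nsinc_ft k R s)"
proof -
  define I where "I = integral {-R..R} (\<lambda>x. nsinc x ^ k *\<^sub>R cis (2 * pi * x * s))"
  have int: "(\<lambda>x. nsinc x ^ k *\<^sub>R cis (2 * pi * x * s)) integrable_on {-R..R}"
    by (intro integrable_continuous_real continuous_intros)
  have "I = integral {-R..R} (\<lambda>x. nsinc (- x) ^ k *\<^sub>R cis (2 * pi * (- x) * s))"
    unfolding I_def using Henstock_Kurzweil_Integration.integral_reflect_real[of R "-R" "\<lambda>x. nsinc x ^ k *\<^sub>R cis (2 * pi * x * s)"] by simp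
  also have "\<dots> = integral {-R..R} (cnj \<circ> (\<lambda>x. nsinc x ^ k *\<^sub>R cis (2 * pi * x * s)))"
    by (simp add: o_def cis_cnj)
  also have "\<dots> = cnj I"
    unfolding I_def by (rule integral_linear[OF int bounded_linear_cnj])
  finally have "Im I = 0" by (simp add: complex_eq_iff)
  moreover have "Re I = integral {-R..R} (Re \<circ> (\<lambda>x. nsinc x ^ k *\<^sub>R cis (2 * pi * x * s)))"
    unfolding I_def by (rule integral_linear[OF int bounded_linear_Re, symmetric])
  then have "Re I = nsinc_ft k R s" by (simp add: nsinc_ft_def o_def)
  ultimately show ?thesis unfolding I_def[symmetric] by (simp add: complex_eq_iff)
qed

lemma integral_character:
  assumes T: "T > 0"
  shows "integral {-T/2..T/2} (\<lambda>x. cis (2 * pi * of_int n * x / T)) = (if n = 0 then of_real T else 0)"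
proof (cases "n = 0")
  case True
  then show ?thesis using T by (simp add: scaleR_conv_of_real)
next
  case False
  define c where "c = 2 * pi * of_int n / T"
  have c: "c \<noteq> 0" using False T by (simp add: c_def)
  \<comment> \<open>An antiderivative of \<open>cis (c * x)\<close>; its values at the two ends of the period agree.\<close>
  define G where "G = (\<lambda>x. cis (c * x) / (\<i> * of_real c))"
  have "((\<lambda>x. cis (c * x)) has_integral G (T/2) - G (-T/2)) {-T/2..T/2}"
  proof (rule fundamental_theorem_of_calculus)
    fix x :: real
    have "((\<lambda>x. cis (c * x)) has_vector_derivative (c *\<^sub>R (\<i> * cis (c * x)))) (at x within {-T/2..T/2})"
      unfolding has_vector_derivative_def
      by (rule derivative_eq_intros refl | simp add: algebra_simps)+
    then have "(G has_vector_derivative (c *\<^sub>R (\<i> * cis (c * x))) / (\<i> * of_real c)) (at x within {-T/2..T/2})"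
      unfolding G_def by (rule has_vector_derivative_divide)
    then show "(G has_vector_derivative cis (c * x)) (at x within {-T/2..T/2})"
      using c by (simp add: scaleR_conv_of_real)
  qed (use T in simp)
  moreover have "cis (c * (T/2)) = cis (c * (-T/2))"
  proof -
    have "cis (c * (T/2)) = cis (c * (-T/2) + 2 * pi * of_int n)"
      using T by (simp add: c_def)
    also have "\<dots> = cis (c * (-T/2))" unfolding cis_mult[symmetric] by (simp add: cis_multiple_2pi)
    finally show ?thesis .
  qed
  ultimately have "integral {-T/2..T/2} (\<lambda>x. cis (c * x)) = 0"
    by (simp add: G_def integral_unique)
  then show ?thesis using False by (simp add: c_def mult_ac)
qed

section \<open>Poisson summation\<close>

lemma nsinc_tendsto_0: "(nsinc \<longlongrightarrow> 0) at_top" "(nsinc \<longlongrightarrow> 0) at_bot"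
proof -
  show 1: "(nsinc \<longlongrightarrow> 0) at_top"
  proof (rule Lim_null_comparison)
    show "\<forall>\<^sub>F x in at_top. norm (nsinc x) \<le> inverse x"
      using eventually_gt_at_top[of 0]
    proof eventually_elim
      case (elim x)
      then show ?case using abs_nsinc_le_inverse[of x] by (simp add: inverse_eq_divide)
    qed
  qed (rule tendsto_inverse_0_at_top[OF filterlim_ident])
  have "((\<lambda>x. nsinc (- x)) \<longlongrightarrow> 0) at_bot"
    by (rule filterlim_compose[OF 1 filterlim_uminus_at_top_at_bot])
  then show "(nsinc \<longlongrightarrow> 0) at_bot" by simp
qed

lemma nsinc_power_tendsto_0:
  assumes "k \<ge> 1"
  shows "((\<lambda>x. nsinc x ^ k) \<longlongrightarrow> 0) at_top" "((\<lambda>x. nsinc x ^ k) \<longlongrightarrow> 0) at_bot"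
  using tendsto_power[OF nsinc_tendsto_0(1), of k] tendsto_power[OF nsinc_tendsto_0(2), of k] assms
  by (simp_all add: power_0_left)

lemma character_periodic:
  "T > 0 \<Longrightarrow> cis (2 * pi * of_int n * (x + T) / T) = cis (2 * pi * of_int n * x / T)"
proof -
  assume T: "T > 0"
  then have "2 * pi * of_int n * (x + T) / T = 2 * pi * of_int n * x / T + 2 * pi * of_int n"
    by (simp add: field_simps)
  then show ?thesis unfolding cis_mult[symmetric] by (simp only: cis_mult[symmetric]) (simp add: cis_multiple_2pi)
qed

lemma filterlim_half_odd_multiple:
  assumes "T > 0"
  shows "filterlim (\<lambda>N. (real N + 1/2) * T) at_top sequentially"
  using filterlim_tendsto_add_at_top[OF tendsto_const[of "1/2 :: real"] filterlim_real_sequentially]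
  by (intro filterlim_at_top_mult_tendsto_pos[OF tendsto_const assms]) (simp add: add.commute)

lemma fourier_integral_periodization_limit:
  assumes T: "T > 0" and k: "k \<ge> 1"
    and F: "\<And>M. uniform_limit {-M..M} (periodization (\<lambda>x. nsinc x ^ k) T) F sequentially"
  shows "integral {-T/2..T/2} (\<lambda>x. F x *\<^sub>R cis (2 * pi * of_int n * x / T)) =
         of_real (conv_power rect k (of_int n / T))"
proof -
  let ?R = "\<lambda>N. (real N + 1/2) * T"
  have "(\<lambda>N. integral {-?R N..?R N} (\<lambda>x. nsinc x ^ k *\<^sub>R cis (2 * pi * of_int n * x / T)))
      \<longlonglongrightarrow> integral {-T/2..T/2} (\<lambda>x. F x *\<^sub>R cis (2 * pi * of_int n * x / T))"
    by (rule tendsto_integral_periodization[OF T _ _ _ F])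
       (auto intro!: absolutely_integrable_continuous_real continuous_intros simp: character_periodic[OF T])
  moreover have "(\<lambda>N. complex_of_real (nsinc_ft k (?R N) (of_int n / T))) \<longlonglongrightarrow> of_real (conv_power rect k (of_int n / T))"
    by (intro tendsto_of_real filterlim_compose[OF nsinc_ft_tendsto[OF k]] filterlim_half_odd_multiple T)
  moreover have "integral {-?R N..?R N} (\<lambda>x. nsinc x ^ k *\<^sub>R cis (2 * pi * of_int n * x / T)) =
      complex_of_real (nsinc_ft k (?R N) (of_int n / T))" for N
    using integral_nsinc_power_cis[of "?R N" k "of_int n / T"] by (simp add: mult_ac)
  ultimately show ?thesis using LIMSEQ_unique by simp
qed

lemma finite_band: "T > 0 \<Longrightarrow> finite {n::int. \<bar>of_int n / T\<bar> \<le> (c::real)}"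
proof (rule finite_subset)
  assume T: "T > 0"
  show "{n::int. \<bar>of_int n / T\<bar> \<le> c} \<subseteq> {- \<lceil>c * T\<rceil>..\<lceil>c * T\<rceil>}"
  proof
    fix n :: int assume "n \<in> {n. \<bar>of_int n / T\<bar> \<le> c}"
    then have "\<bar>real_of_int n\<bar> \<le> c * T" using T by (simp add: field_simps)
    then show "n \<in> {- \<lceil>c * T\<rceil>..\<lceil>c * T\<rceil>}" by (auto simp: abs_le_iff; linarith)
  qed
qed simp

text \<open>
  Both sides are continuous and periodic, so it suffices to compare Fourier coefficients. Those of
  index outside the finite sum vanish by the support property of \<open>\<Pi>^{*k}\<close>.
\<close>

lemma poisson_summation_nsinc_power:
  assumes T: "T > 0" and k: "k \<ge> 1"
    and F: "\<And>M. uniform_limit {-M..M} (periodization (\<lambda>x. nsinc x ^ k) T) F sequentially"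
    and x: "x \<in> {-T/2..T/2}"
  shows "complex_of_real (F x) = (\<Sum>n | \<bar>real_of_int n / T\<bar> \<le> real k / 2.
      of_real (conv_power rect k (of_int n / T) / T) * cis (2 * pi * of_int (- n) * x / T))"
proof -
  define A where "A = {n::int. \<bar>real_of_int n / T\<bar> \<le> real k / 2}"
  have A: "finite A" unfolding A_def by (rule finite_band[OF T])
  define c where "c = (\<lambda>n::int. conv_power rect k (of_int n / T))"
  define e where "e = (\<lambda>(n::int) x. cis (2 * pi * of_int n * x / T))"
  define Q where "Q = (\<lambda>x. \<Sum>n\<in>A. complex_of_real (c n / T) * e (- n) x)"
  define h where "h = (\<lambda>x. complex_of_real (F x) - Q x)"
  have nsinc_k: "continuous_on UNIV (\<lambda>x. nsinc x ^ k)" by (intro continuous_intros)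
  have contF: "continuous_on S F" for S
    using continuous_on_periodization_limit[OF nsinc_k F] continuous_on_subset by blast
  have conte: "continuous_on S (e n)" for S n
    unfolding e_def by (intro continuous_intros)
  have contQ: "continuous_on S Q" for S
    unfolding Q_def by (intro continuous_intros conte)
  have per: "h (x + T) = h x" for x
    using periodic_periodization_limit[OF T F nsinc_power_tendsto_0[OF k]]
    by (simp add: h_def Q_def e_def character_periodic[OF T] del: of_int_minus)
  have e_mult: "e m x * e n x = e (m + n) x" for m n x
    unfolding e_def cis_mult by (simp add: add_divide_distrib distrib_left distrib_right)
  have "integral {-T/2..T/2} (\<lambda>x. e m x * h x) = 0" for m
  proof -
    have "integral {-T/2..T/2} (\<lambda>x. e m x * Q x) =
        integral {-T/2..T/2} (\<lambda>x. \<Sum>n\<in>A. complex_of_real (c n / T) * e (m - n) x)"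
      unfolding Q_def sum_distrib_left mult.left_commute[of "e m _"] e_mult by simp
    also have "\<dots> = (\<Sum>n\<in>A. complex_of_real (c n / T) * integral {-T/2..T/2} (e (m - n)))"
      by (subst integral_sum[OF A])
         (use T in \<open>auto intro!: integrable_continuous_real continuous_intros conte\<close>)
    also have "\<dots> = (\<Sum>n\<in>A. if n = m then of_real (c m) else 0)"
      unfolding e_def integral_character[OF T] using T by (intro sum.cong) auto
    also have "\<dots> = of_real (c m)"
    proof (cases "m \<in> A")
      case False
      then have "c m = 0"
        unfolding c_def A_def by (intro conv_power_rect_eq_0[OF k]) auto
      then show ?thesis using A False by simp
    qed (use A in simp)
    finally have "integral {-T/2..T/2} (\<lambda>x. e m x * Q x) = of_real (c m)" .
    moreover have "integral {-T/2..T/2} (\<lambda>x. e m x * of_real (F x)) = of_real (c m)"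
      using fourier_integral_periodization_limit[OF T k F, of m]
      by (simp add: e_def c_def scaleR_conv_of_real mult.commute)
    ultimately show ?thesis
      unfolding h_def right_diff_distrib
      by (subst integral_diff) (auto intro!: integrable_continuous_real continuous_intros conte contF contQ)
  qed
  then have "orthogonal_to_characters T h"
    unfolding orthogonal_to_characters_def e_def
    by (auto simp: h_def intro!: continuous_intros contF contQ)
  then have "h x = 0"
    using orthogonal_to_characters_eq_0[of T h x] T per x by blast
  then show ?thesis by (simp add: h_def Q_def A_def c_def e_def)
qed

lemma integral_periodization_limit_eq_fourier_sum:
  assumes T: "T > 0" and k: "k \<ge> 1"
    and F: "\<And>M. uniform_limit {-M..M} (periodization (\<lambda>x. nsinc x ^ k) T) F sequentially"
    and p: "p absolutely_integrable_on {-T/2..T/2}"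
  shows "integral {-T/2..T/2} (\<lambda>x. F x *\<^sub>R p x) = (\<Sum>n | \<bar>real_of_int n / T\<bar> \<le> real k / 2.
      fourier_coeff T p n * of_real (conv_power rect k (of_int n / T)))"
proof -
  define A where "A = {n::int. \<bar>real_of_int n / T\<bar> \<le> real k / 2}"
  have A: "finite A" unfolding A_def by (rule finite_band[OF T])
  define c where "c = (\<lambda>n::int. conv_power rect k (of_int n / T))"
  define e where "e = (\<lambda>(n::int) x. cis (2 * pi * of_int n * x / T))"
  have ep: "(\<lambda>x. e n x * p x) absolutely_integrable_on {-T/2..T/2}" for n
  proof (rule absolutely_integrable_bounded_measurable_product[where h = "(*)" and f = "e n", OF _ _ _ _ p])
    have cont: "continuous_on {-T/2..T/2} (e n)" unfolding e_def by (intro continuous_intros)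
    show "bilinear ((*) :: complex \<Rightarrow> complex \<Rightarrow> complex)"
      by (simp add: bilinear_conv_bounded_bilinear bounded_bilinear_mult)
    show "e n \<in> borel_measurable (lebesgue_on {-T/2..T/2})"
      by (rule continuous_imp_measurable_on_sets_lebesgue[OF cont]) simp
    show "bounded (e n ` {-T/2..T/2})"
      using compact_continuous_image[OF cont] compact_imp_bounded by blast
  qed simp
  have coeff: "fourier_coeff T p n = integral {-T/2..T/2} (\<lambda>x. e (- n) x * p x) / of_real T" for n
  proof -
    have "exp (- 2 * complex_of_real pi * \<i> * of_int n * of_real x / of_real T) = e (- n) x" for x
      by (simp add: e_def cis_conv_exp mult_ac)
    then show ?thesis
      unfolding fourier_coeff_def using set_lebesgue_integral_eq_integral(2)[OF ep[of "- n"]] by simp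
  qed
  have "integral {-T/2..T/2} (\<lambda>x. F x *\<^sub>R p x) =
      integral {-T/2..T/2} (\<lambda>x. \<Sum>n\<in>A. of_real (c n / T) * (e (- n) x * p x))"
    by (intro integral_cong)
       (simp only: scaleR_conv_of_real poisson_summation_nsinc_power[OF T k F] A_def c_def e_def sum_distrib_right mult.assoc)
  also have "\<dots> = (\<Sum>n\<in>A. of_real (c n / T) * integral {-T/2..T/2} (\<lambda>x. e (- n) x * p x))"
    unfolding integral_mult_right[symmetric]
    by (rule integral_sum[OF A]) (intro integrable_on_mult_right set_lebesgue_integral_eq_integral(1) ep)
  also have "\<dots> = (\<Sum>n\<in>A. fourier_coeff T p n * of_real (c n))"
    unfolding coeff by (intro sum.cong) auto
  finally show ?thesis by (simp add: A_def c_def)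
qed

text \<open>
  An arbitrary \<open>R\<close> exceeds some \<open>(N + 1/2) T\<close> by at most one period. On the two pieces left over,
  \<open>p\<close> has a fixed integral norm while \<open>f\<close> is small.
\<close>

lemma tendsto_integral_between_cells:
  fixes p :: "real \<Rightarrow> 'a::euclidean_space"
  assumes T: "T > 0" and per: "\<And>x. p (x + T) = p x"
    and p: "p absolutely_integrable_on {-T/2..T/2}"
    and f: "continuous_on UNIV f" "(f \<longlongrightarrow> 0) at_top" "(f \<longlongrightarrow> 0) at_bot"
    and lim: "(\<lambda>N. integral {-((real N + 1/2) * T)..(real N + 1/2) * T} (\<lambda>x. f x *\<^sub>R p x)) \<longlonglongrightarrow> L"
  shows "((\<lambda>R. integral {-R..R} (\<lambda>x. f x *\<^sub>R p x)) \<longlongrightarrow> L) at_top"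
proof -
  define a where "a = (\<lambda>N. (real N + 1/2) * T)"
  \<comment> \<open>The largest \<open>N\<close> with \<open>(N + 1/2) T \<le> R\<close>.\<close>
  define N where "N = (\<lambda>R. nat \<lfloor>R / T - 1/2\<rfloor>)"
  define g where "g = (\<lambda>x. f x *\<^sub>R p x)"
  define P where "P = integral {-T/2..T/2} (\<lambda>x. norm (p x))"
  have pI: "p absolutely_integrable_on {u..v}" for u v
    by (rule periodic_absolutely_integrable[OF T per p])
  have np: "(\<lambda>x. norm (p x)) integrable_on {u..v}" for u v
    using pI by (auto simp: absolutely_integrable_on_def)
  have g: "g integrable_on {u..v}" for u v
    unfolding g_def
    by (intro set_lebesgue_integral_eq_integral(1) absolutely_integrable_continuous_scaleR pI
          continuous_on_subset[OF f(1)]) auto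
  have P: "P \<ge> 0" unfolding P_def by (intro integral_nonneg np) auto
  have cell: "integral {-T/2 + of_int m * T..T/2 + of_int m * T} (\<lambda>x. norm (p x)) = P" for m :: int
    using integral_shift_real_ivl[of "-T/2 + of_int m * T" "of_int m * T" "T/2 + of_int m * T" "\<lambda>x. norm (p x)"]
      periodic_int_multiple[of p T _ m, OF per]
    by (simp add: P_def)
  have piece: "norm (integral {u..v} g) \<le> d * P"
    if sub: "{u..v} \<subseteq> {-T/2 + of_int m * T..T/2 + of_int m * T}" and d: "\<And>x. x \<in> {u..v} \<Longrightarrow> \<bar>f x\<bar> \<le> d" "d \<ge> 0"
    for u v d and m :: int
  proof -
    have "norm (integral {u..v} g) \<le> integral {u..v} (\<lambda>x. d * norm (p x))"
      by (rule integral_norm_bound_integral[OF g])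
         (use d in \<open>auto simp: g_def intro!: integrable_on_mult_right np mult_right_mono\<close>)
    also have "\<dots> = d * integral {u..v} (\<lambda>x. norm (p x))" by simp
    also have "\<dots> \<le> d * integral {-T/2 + of_int m * T..T/2 + of_int m * T} (\<lambda>x. norm (p x))"
      by (intro mult_left_mono integral_subset_le sub np d) auto
    finally show ?thesis by (simp only: cell)
  qed
  have N: "filterlim N at_top at_top"
  proof -
    have "filterlim (\<lambda>R. - (1/2) + R * (1 / T)) at_top at_top"
      using T by (intro filterlim_tendsto_add_at_top[OF tendsto_const]
        filterlim_at_top_mult_tendsto_pos[OF tendsto_const] filterlim_ident) auto
    then have "filterlim (\<lambda>R. R / T - 1/2) at_top at_top" by simp
    then show ?thesis unfolding N_def
      by (intro filterlim_compose[OF filterlim_nat_sequentially] filterlim_compose[OF filterlim_floor_sequentially])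
  qed
  have "((\<lambda>R. integral {-R..R} g - integral {-a (N R)..a (N R)} g) \<longlongrightarrow> 0) at_top"
  proof (rule tendstoI)
    fix e :: real assume e: "e > 0"
    \<comment> \<open>Each of the two pieces contributes at most \<open>d * P\<close>, and \<open>P\<close> may vanish.\<close>
    define d where "d = e / (2 * P + 1)"
    have d: "d > 0" using e P by (simp add: d_def)
    obtain b1 where b1: "\<And>x. x \<ge> b1 \<Longrightarrow> \<bar>f x\<bar> < d"
      using tendstoD[OF f(2) d] by (auto simp: eventually_at_top_linorder dist_real_def)
    obtain b2 where b2: "\<And>x. x \<le> b2 \<Longrightarrow> \<bar>f x\<bar> < d"
      using tendstoD[OF f(3) d] by (auto simp: eventually_at_bot_linorder dist_real_def)
    show "\<forall>\<^sub>F R in at_top. dist (integral {-R..R} g - integral {-a (N R)..a (N R)} g) 0 < e"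
      using eventually_ge_at_top[of "T + \<bar>b1\<bar> + \<bar>b2\<bar>"]
    proof eventually_elim
      case (elim R)
      define A where "A = a (N R)"
      have "R / T \<ge> 1" using elim T by (simp add: field_simps)
      then have "real (N R) \<le> R / T - 1/2" "R / T - 1/2 < real (N R) + 1"
        unfolding N_def by linarith+
      then have "real (N R) + 1/2 \<le> R / T" "R / T \<le> real (N R) + 1 + 1/2" by linarith+
      then have A: "A \<le> R" "R \<le> A + T" "0 < A"
        using T by (simp_all add: A_def a_def field_simps add_pos_nonneg)
      have m: "- T/2 + of_int (int (Suc (N R))) * T = A" "T/2 + of_int (int (Suc (N R))) * T = A + T"
        "- T/2 + of_int (- int (Suc (N R))) * T = - (A + T)" "T/2 + of_int (- int (Suc (N R))) * T = - A"
        by (simp_all add: A_def a_def field_simps)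
      have "integral {-R..R} g = integral {-R..-A} g + (integral {-A..A} g + integral {A..R} g)"
      proof -
        have "integral {-R..-A} g + integral {-A..R} g = integral {-R..R} g"
          "integral {-A..A} g + integral {A..R} g = integral {-A..R} g"
          using A T by (auto intro!: Henstock_Kurzweil_Integration.integral_combine g)
        then show ?thesis by simp
      qed
      then have "norm (integral {-R..R} g - integral {-A..A} g) \<le> norm (integral {-R..-A} g) + norm (integral {A..R} g)"
        using norm_triangle_ineq by simp
      also have "norm (integral {-R..-A} g) \<le> d * P"
      proof (rule piece)
        show "{-R..-A} \<subseteq> {- T/2 + of_int (- int (Suc (N R))) * T..T/2 + of_int (- int (Suc (N R))) * T}"
          unfolding m using A by auto
        show "\<bar>f x\<bar> \<le> d" if "x \<in> {-R..-A}" for x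
        proof -
          have "x \<le> b2" using that A elim by (simp, linarith)
          then show ?thesis by (rule less_imp_le[OF b2])
        qed
      qed (use d in simp)
      also have "norm (integral {A..R} g) \<le> d * P"
      proof (rule piece)
        show "{A..R} \<subseteq> {- T/2 + of_int (int (Suc (N R))) * T..T/2 + of_int (int (Suc (N R))) * T}"
          unfolding m using A by auto
        show "\<bar>f x\<bar> \<le> d" if "x \<in> {A..R}" for x
        proof -
          have "b1 \<le> x" using that A elim by (simp, linarith)
          then show ?thesis by (rule less_imp_le[OF b1])
        qed
      qed (use d in simp)
      also have "d * P + d * P < d * (2 * P + 1)" using d by (simp add: algebra_simps)
      also have "\<dots> = e" using P by (simp add: d_def)
      finally show ?case by (simp add: A_def)
    qed
  qed
  moreover have "((\<lambda>R. integral {-a (N R)..a (N R)} g) \<longlongrightarrow> L) at_top"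
    using filterlim_compose[OF lim N] by (simp add: a_def g_def)
  ultimately have "((\<lambda>R. (integral {-R..R} g - integral {-a (N R)..a (N R)} g) + integral {-a (N R)..a (N R)} g) \<longlongrightarrow> 0 + L) at_top"
    by (rule tendsto_add)
  then show ?thesis by (simp add: g_def)
qed

section \<open>Absolute convergence and the theorem\<close>

text \<open>
  Unfolding applied to \<open>|sinc^k|\<close> and \<open>|p|\<close> bounds the integrals of \<open>|sinc^k p|\<close> over growing
  intervals, because the periodization of a quadratically decaying function converges;
  monotone convergence concludes.
\<close>

lemma integrable_nsinc_power_scaleR:
  fixes p :: "real \<Rightarrow> 'a::euclidean_space"
  assumes T: "T > 0" and per: "\<And>x. p (x + T) = p x"
    and p: "p absolutely_integrable_on {-T/2..T/2}" and k: "k \<ge> 2"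
  shows "integrable lebesgue (\<lambda>x. nsinc x ^ k *\<^sub>R p x)"
proof -
  define g where "g = (\<lambda>x. nsinc x ^ k *\<^sub>R p x)"
  define a where "a = (\<lambda>N. (real N + 1/2) * T)"
  have f: "continuous_on UNIV (\<lambda>x. \<bar>nsinc x ^ k\<bar>)" "continuous_on UNIV (\<lambda>x. nsinc x ^ k)"
    by (intro continuous_intros)+
  have gI: "g absolutely_integrable_on {u..v}" for u v
    unfolding g_def
    by (intro absolutely_integrable_continuous_scaleR periodic_absolutely_integrable[OF T per p]
          continuous_on_subset[OF f(2)]) auto
  have np: "(\<lambda>x. norm (p x)) absolutely_integrable_on {-T/2..T/2}"
    using p by (rule set_integrable_norm)
  have a: "filterlim a at_top sequentially"
    unfolding a_def by (rule filterlim_half_odd_multiple[OF T])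
  obtain F where F: "\<And>M. uniform_limit {-M..M} (periodization (\<lambda>x. \<bar>nsinc x ^ k\<bar>) T) F sequentially"
    using uniform_limit_periodization_quadratic_decay[OF T, of "\<lambda>x. \<bar>nsinc x ^ k\<bar>"] abs_nsinc_power_le[OF k] by auto
  have lim: "(\<lambda>N. integral {- a N..a N} (\<lambda>x. norm (g x))) \<longlonglongrightarrow> integral {-T/2..T/2} (\<lambda>x. F x *\<^sub>R norm (p x))"
    using tendsto_integral_periodization[OF T _ np f(1) F] per by (simp add: a_def g_def)
  have eventually_in: "\<forall>\<^sub>F N in sequentially. x \<in> {- a N..a N}" for x
    using filterlim_at_top[THEN iffD1, OF a, rule_format, of "\<bar>x\<bar>"] by eventually_elim auto
  have ind: "(\<lambda>N. indicator {- a N..a N} x *\<^sub>R h x) \<longlonglongrightarrow> h x" for x and h :: "real \<Rightarrow> 'b::real_normed_vector"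
    by (rule tendsto_eventually) (use eventually_in[of x] in eventually_elim, simp)
  have meas: "g \<in> borel_measurable lebesgue"
  proof (rule borel_measurable_LIMSEQ_metric)
    show "(\<lambda>x. indicator {- a N..a N} x *\<^sub>R g x) \<in> borel_measurable lebesgue" for N
      using gI[of "- a N" "a N"] unfolding set_integrable_def by (rule borel_measurable_integrable)
  qed (rule ind)
  have "integrable lebesgue (\<lambda>x. norm (g x))"
  proof (rule integrable_monotone_convergence)
    show "integrable lebesgue (\<lambda>x. indicator {- a N..a N} x *\<^sub>R norm (g x))" for N
      using set_integrable_norm[OF gI] unfolding set_integrable_def .
    show "AE x in lebesgue. mono (\<lambda>N. indicator {- a N..a N} x *\<^sub>R norm (g x))"
    proof (intro AE_I2 monoI)
      fix x and M N :: nat assume "M \<le> N"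
      then have "a M \<le> a N" using T by (simp add: a_def)
      then show "indicator {- a M..a M} x *\<^sub>R norm (g x) \<le> indicator {- a N..a N} x *\<^sub>R norm (g x)"
        by (auto simp: indicator_def)
    qed
    show "AE x in lebesgue. (\<lambda>N. indicator {- a N..a N} x *\<^sub>R norm (g x)) \<longlonglongrightarrow> norm (g x)"
      by (intro AE_I2 ind)
    have "(LINT x|lebesgue. indicator {- a N..a N} x *\<^sub>R norm (g x)) = integral {- a N..a N} (\<lambda>x. norm (g x))" for N
      using set_lebesgue_integral_eq_integral(2)[OF set_integrable_norm[OF gI]]
      unfolding set_lebesgue_integral_def .
    with lim show "(\<lambda>N. LINT x|lebesgue. indicator {- a N..a N} x *\<^sub>R norm (g x)) \<longlonglongrightarrow> integral {-T/2..T/2} (\<lambda>x. F x *\<^sub>R norm (p x))"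
      by simp
    show "(\<lambda>x. norm (g x)) \<in> borel_measurable lebesgue"
      using meas by measurable
  qed
  then have "integrable lebesgue g"
    using meas by (simp add: integrable_norm_iff)
  then show ?thesis by (simp add: g_def)
qed

lemma has_pv_integral_lebesgue_integral_unique:
  assumes "has_pv_integral f I" "integrable lebesgue f"
  shows "(LINT x|lebesgue. f x) = I"
proof -
  have "((\<lambda>R. LINT x:{-R..R}|lebesgue. f x) \<longlongrightarrow> (LINT x|lebesgue. f x)) at_top"
    unfolding set_lebesgue_integral_def
  proof (rule integral_dominated_convergence_at_top)
    show "integrable lebesgue (\<lambda>x. norm (f x))" using assms(2) by simp
    show "(\<lambda>x. indicator {-R..R} x *\<^sub>R f x) \<in> borel_measurable lebesgue" for R
      using assms(2) by (intro borel_measurable_scaleR borel_measurable_indicator) auto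
    show "\<forall>\<^sub>F R in at_top. AE x in lebesgue. norm (indicator {-R..R} x *\<^sub>R f x) \<le> norm (f x)"
      by (intro always_eventually allI AE_I2) (simp add: indicator_def)
    show "AE x in lebesgue. ((\<lambda>R. indicator {-R..R} x *\<^sub>R f x) \<longlongrightarrow> f x) at_top"
    proof (intro AE_I2 tendsto_eventually)
      fix x
      show "\<forall>\<^sub>F R in at_top. indicator {-R..R} x *\<^sub>R f x = f x"
        using eventually_ge_at_top[of "\<bar>x\<bar>"] by eventually_elim (simp add: indicator_def abs_le_iff)
    qed
  qed (use assms(2) in auto)
  then show ?thesis
    using assms(1) tendsto_unique[OF trivial_limit_at_top_linorder] unfolding has_pv_integral_def by blast
qed

theorem theorem4:
  fixes T :: real and p :: "real \<Rightarrow> complex" and k :: nat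
  assumes "T > 0"
    and "\<And>x. p (x + T) = p x"
    and "p absolutely_integrable_on {-T/2..T/2}"
    and "k \<ge> 1"
  shows "has_pv_integral (\<lambda>x. of_real (nsinc x ^ k) * p x)
           (\<Sum>n | \<bar>real_of_int n / T\<bar> \<le> real k / 2.
              fourier_coeff T p n * of_real (conv_power rect k (real_of_int n / T))) \<and>
         (k \<ge> 2 \<longrightarrow>
           integrable lebesgue (\<lambda>x. of_real (nsinc x ^ k) * p x) \<and>
           (LINT x|lebesgue. of_real (nsinc x ^ k) * p x) =
             (\<Sum>n | \<bar>real_of_int n / T\<bar> \<le> real k / 2.
                fourier_coeff T p n * of_real (conv_power rect k (real_of_int n / T))) \<and>
           (LINT x|lebesgue. of_real (nsinc x ^ k) * p x) =
             (\<Sum>n | \<bar>real_of_int n / T\<bar> < real k / 2.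
                fourier_coeff T p n * of_real (conv_power rect k (real_of_int n / T))))"
proof -
  note T = assms(1) and per = assms(2) and p = assms(3) and k = assms(4)
  define S where "S = (\<Sum>n | \<bar>real_of_int n / T\<bar> \<le> real k / 2.
              fourier_coeff T p n * of_real (conv_power rect k (real_of_int n / T)))"
  have f: "continuous_on UNIV (\<lambda>x. nsinc x ^ k)" by (intro continuous_intros)
  obtain F where F: "\<And>M. uniform_limit {-M..M} (periodization (\<lambda>x. nsinc x ^ k) T) F sequentially"
    using uniform_limit_periodization_nsinc_power[OF T k] by blast
  have lim: "((\<lambda>R. integral {-R..R} (\<lambda>x. nsinc x ^ k *\<^sub>R p x)) \<longlongrightarrow> S) at_top"
    unfolding S_def integral_periodization_limit_eq_fourier_sum[OF T k F p, symmetric]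
    by (rule tendsto_integral_between_cells[OF T per p f nsinc_power_tendsto_0[OF k]])
       (rule tendsto_integral_periodization[OF T per p f F])
  have loc: "(\<lambda>x. nsinc x ^ k *\<^sub>R p x) absolutely_integrable_on {-R..R}" for R
    by (intro absolutely_integrable_continuous_scaleR periodic_absolutely_integrable[OF T per p]
          continuous_on_subset[OF f]) auto
  have pv: "has_pv_integral (\<lambda>x. of_real (nsinc x ^ k) * p x) S"
    unfolding has_pv_integral_def scaleR_conv_of_real[symmetric]
    using lim loc by (simp only: set_lebesgue_integral_eq_integral(2)[OF loc]) simp
  have "integrable lebesgue (\<lambda>x. of_real (nsinc x ^ k) * p x)" if "k \<ge> 2"
    using integrable_nsinc_power_scaleR[OF T per p that] by (simp only: scaleR_conv_of_real)
  moreover have "S = (\<Sum>n | \<bar>real_of_int n / T\<bar> < real k / 2.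
      fourier_coeff T p n * of_real (conv_power rect k (real_of_int n / T)))" if "k \<ge> 2"
    unfolding S_def
  proof (rule sum.mono_neutral_right[OF finite_band[OF T]])
    show "\<forall>n\<in>{n. \<bar>real_of_int n / T\<bar> \<le> real k / 2} - {n. \<bar>real_of_int n / T\<bar> < real k / 2}.
       fourier_coeff T p n * of_real (conv_power rect k (real_of_int n / T)) = 0"
    proof
      fix n assume "n \<in> {n. \<bar>real_of_int n / T\<bar> \<le> real k / 2} - {n. \<bar>real_of_int n / T\<bar> < real k / 2}"
      then have "\<bar>real_of_int n / T\<bar> = real k / 2" by simp
      then show "fourier_coeff T p n * of_real (conv_power rect k (real_of_int n / T)) = 0"
        using conv_power_rect_eq_0[OF k, of "real_of_int n / T"] that by simp
    qed
  qed auto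
  ultimately show ?thesis
    using pv has_pv_integral_lebesgue_integral_unique[OF pv] unfolding S_def by simp
qed

end
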